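(* For any finite Coxeter system $(W,S)$, the quantum Dunkl elements $\tilde\theta_s$ ($s\in S$) in the quantized bracket algebra $qBE(W,S)$ commute pairwise.
   Context: Let $(W,S)$ be a finite Coxeter system, $V$ the real vector space with basis $\{\alpha_s\}_{s\in S}$ and form $(\alpha_s,\alpha_{s'})=-\cos(\pi/m(s,s'))$, $W$ acting by $s(\lambda)=\lambda-2(\alpha_s,\lambda)\alpha_s$, $\Delta=\{w(\alpha_s)\}$ the roots (normalized so that $2(\gamma,\gamma')/(\gamma,\gamma)\in\mathbb Z$ if $(W,S)$ is crystallographic), $\Delta_+$ the positive roots, $s_\gamma$ the reflection in $\gamma$, $l$ the length function, $\gamma^\vee=2\gamma/(\gamma,\gamma)$, $\rho=\frac12\sum_{\gamma\in\Delta_+}\gamma$, $\omega_s$ the fundamental weights with $(\omega_s,\alpha_{s'}^\vee)=\delta_{s,s'}$. $qBE(W,S)$ is the associative algebra over $\mathbb R[q_s\mid s\in S]$ with generators $[\gamma]$, $\gamma\in\Delta$, and relations: (i) $[-\gamma]=-[\gamma]$; (ii) for $\gamma\in\Delta_+$, $[\gamma]^2=q_s$ if $\gamma=\alpha_s$, and $[\gamma]^2=0$ otherwise; (iii) whenever $\gamma_0,\dots,\gamma_{m-1}\in\Delta_+$ ($m\ge2$) are such that $\{\pm\gamma_i\}$ is a root system of type $I_2(m)$ and $\mathbb R_{\ge0}\gamma_i+\mathbb R_{\ge0}\gamma_{i+1}$ meets $\Delta_+$ exactly in $\{\gamma_i,\gamma_{i+1}\}$ for $i=0,\dots,m-2$,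 then with $\gamma_{j+m}=-\gamma_j$: $\sum_{i=0}^{m-1}[\gamma_i][\gamma_{i+k}]=0$ for each integer $1\le k\le m/2$; (iv) for such $\gamma_0,\dots,\gamma_{m-1}$ with $m\ge4$, $k=\lfloor m/2\rfloor-1$ and $l(s_{\gamma_k})\ne2(\rho,\gamma_k^\vee)-1$: $[\gamma_k][\gamma_0]\cdots[\gamma_{2k}]+[\gamma_0]\cdots[\gamma_{2k}][\gamma_k]+[\gamma_k][\gamma_{2k}]\cdots[\gamma_0]+[\gamma_{2k}]\cdots[\gamma_0][\gamma_k]=0$. Quantum Chevalley elements $\tilde\eta_s=\sum_{\gamma\in\Delta_+}(\omega_s,\gamma^\vee)[\gamma]$, quantum Dunkl elements $\tilde\theta_s=\sum_{s'}(\alpha_s,\alpha_{s'})\tilde\eta_{s'}$.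
   Formalization: The coefficients (ω_s,γ^∨) and (α_s,α_s') are computed with unit roots w(α_s); the crystallographic rescaling of roots enters only the side condition of relation (iv). With rescaled coroots in the Chevalley elements the claim fails in type B_2. *)

theory Defs
  imports
    Complex_Main
    "HOL-Library.Poly_Mapping"
    "HOL-Library.Function_Algebras"
    "HOL-Algebra.Generated_Groups"
    "HOL-Algebra.Multiplicative_Group"
    "HOL-Algebra.QuotRing"
begin

section \<open>Coxeter systems\<close>

definition coxeter_m :: "('a, 'b) monoid_scheme \<Rightarrow> 'a \<Rightarrow> 'a \<Rightarrow> nat" where
  "coxeter_m W s t = group.ord W (s \<otimes>\<^bsub>W\<^esub> t)"

definition word_prod :: "('a, 'b) monoid_scheme \<Rightarrow> 'a list \<Rightarrow> 'a" where
  "word_prod W ws = foldr (\<otimes>\<^bsub>W\<^esub>) ws \<one>\<^bsub>W\<^esub>"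

text \<open>Equality of words in the group presented by the generators \<open>S\<close> and the relations
  \<open>(s t)^m(s,t) = 1\<close>. The relators with \<open>s = t\<close> are the words \<open>s s\<close>, so formal inverses of
  generators are not needed; an infinite order is \<open>0\<close> in the library and gives the empty relator.\<close>

inductive coxeter_equiv :: "('a, 'b) monoid_scheme \<Rightarrow> 'a set \<Rightarrow> 'a list \<Rightarrow> 'a list \<Rightarrow> bool"
  for W S where
  refl: "coxeter_equiv W S u u"
| sym: "coxeter_equiv W S u v \<Longrightarrow> coxeter_equiv W S v u"
| trans: "coxeter_equiv W S u v \<Longrightarrow> coxeter_equiv W S v w \<Longrightarrow> coxeter_equiv W S u w"
| relator: "s \<in> S \<Longrightarrow> t \<in> S \<Longrightarrow>
    coxeter_equiv W S (u @ concat (replicate (coxeter_m W s t) [s, t]) @ v) (u @ v)"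

definition coxeter_system :: "('a, 'b) monoid_scheme \<Rightarrow> 'a set \<Rightarrow> bool" where
  "coxeter_system W S \<longleftrightarrow>
     group W \<and> S \<subseteq> carrier W \<and> generate W S = carrier W \<and>
     (\<forall>s\<in>S. group.ord W s = 2) \<and>
     (\<forall>ws\<in>lists S. word_prod W ws = \<one>\<^bsub>W\<^esub> \<longrightarrow> coxeter_equiv W S ws [])"

section \<open>Free associative algebras over polynomial rings\<close>

text \<open>Words form a monoid under concatenation, so that \<^typ>\<open>'v list \<Rightarrow>\<^sub>0 'r\<close> with the
  convolution product is the free associative algebra over \<open>'r\<close> on the type \<open>'v\<close>.\<close>

instantiation list :: (type) monoid_add
begin
definition "(0 :: 'a list) = []"
definition "(xs :: 'a list) + ys = xs @ ys"
instance by standard (simp_all add: zero_list_def plus_list_def)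
end

type_synonym 'a rpoly = "('a \<Rightarrow>\<^sub>0 nat) \<Rightarrow>\<^sub>0 real"

definition poly_var :: "'a \<Rightarrow> 'a rpoly" where
  "poly_var s = Poly_Mapping.single (Poly_Mapping.single s 1) 1"

definition poly_const :: "real \<Rightarrow> 'a rpoly" where
  "poly_const r = Poly_Mapping.single 0 r"

definition polys :: "'a set \<Rightarrow> 'a rpoly set" where
  "polys S = {p. \<forall>m\<in>Poly_Mapping.keys p. Poly_Mapping.keys m \<subseteq> S}"

type_synonym ('a, 'v) free_alg = "'v list \<Rightarrow>\<^sub>0 'a rpoly"

definition fgen :: "'v \<Rightarrow> ('a, 'v) free_alg" where
  "fgen x = Poly_Mapping.single [x] 1"

definition fscalar :: "'a rpoly \<Rightarrow> ('a, 'v) free_alg" where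
  "fscalar p = Poly_Mapping.single [] p"

definition free_algebra :: "'a set \<Rightarrow> 'v set \<Rightarrow> ('a, 'v) free_alg ring" where
  "free_algebra S G =
    \<lparr>carrier = {f. Poly_Mapping.keys f \<subseteq> lists G \<and> (\<forall>w. Poly_Mapping.lookup f w \<in> polys S)},
     monoid.mult = (*), one = 1, ring.zero = 0, add = (+)\<rparr>"

lemma polys_add: "p \<in> polys S \<Longrightarrow> q \<in> polys S \<Longrightarrow> p + q \<in> polys S"
  unfolding polys_def using keys_add[of p q] by blast

lemma polys_uminus: "p \<in> polys S \<Longrightarrow> - p \<in> polys S"
  unfolding polys_def by simp

lemma polys_0: "0 \<in> polys S" by (simp add: polys_def)

lemma polys_1: "1 \<in> polys S" by (simp add: polys_def)

lemma polys_mult: assumes "p \<in> polys S" "q \<in> polys S" shows "p * q \<in> polys S"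
proof -
  { fix m assume "m \<in> Poly_Mapping.keys (p * q)"
    then obtain a b where "a \<in> Poly_Mapping.keys p" "b \<in> Poly_Mapping.keys q" "m = a + b"
      using keys_mult[of p q] by blast
    moreover have "Poly_Mapping.keys (a + b) \<subseteq> Poly_Mapping.keys a \<union> Poly_Mapping.keys b" by (rule keys_add)
    ultimately have "Poly_Mapping.keys m \<subseteq> S" using assms unfolding polys_def by blast }
  then show ?thesis unfolding polys_def by blast
qed

lemma polys_Sum_any: assumes "\<And>x. f x \<in> polys S" shows "Sum_any f \<in> polys S"
proof -
  have "sum f A \<in> polys S" for A
    by (induction A rule: infinite_finite_induct) (auto simp: polys_0 polys_add assms)
  then show ?thesis unfolding Sum_any.expand_set .
qed

lemma ring_free_algebra: fixes S :: "'a set" and G :: "'v set" shows "ring (free_algebra S G)"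
proof -
  have mult: "f * g \<in> carrier (free_algebra S G)"
    if "f \<in> carrier (free_algebra S G)" "g \<in> carrier (free_algebra S G)" for f g :: "('a,'v) free_alg"
  proof -
    have "Poly_Mapping.keys (f * g) \<subseteq> lists G"
      using keys_mult[of f g] that by (fastforce simp: free_algebra_def plus_list_def)
    moreover have "Poly_Mapping.lookup (f * g) w \<in> polys S" for w
    proof -
      have F: "Poly_Mapping.lookup f v \<in> polys S" "Poly_Mapping.lookup g v \<in> polys S" for v
        using that by (auto simp: free_algebra_def)
      show ?thesis unfolding times_poly_mapping.rep_eq prod_fun_def
        by (intro polys_Sum_any polys_mult F) (auto simp: when_def polys_0 F)
    qed
    ultimately show ?thesis by (simp add: free_algebra_def)
  qed
  have inv: "\<exists>y\<in>carrier (free_algebra S G). y + x = 0 \<and> x + y = 0" 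
    if "x \<in> carrier (free_algebra S G)" for x :: "('a,'v) free_alg"
    using that by (intro bexI[of _ "-x"]) (auto simp: free_algebra_def polys_uminus)
  show ?thesis
  proof (intro ringI abelian_groupI monoidI, goal_cases)
    case (1 x y) then show ?case using keys_add[of x y]
      by (auto simp: free_algebra_def lookup_add polys_add dest!: subsetD)
  next case (6 x) then show ?case using inv[of x] by (auto simp: free_algebra_def)
  next case (7 x y) then show ?case using mult[of x y] by (simp add: free_algebra_def)
  qed (auto simp: free_algebra_def polys_0 polys_1 lookup_one when_def zero_list_def algebra_simps)
qed

section \<open>Roots\<close>

type_synonym 'a vec = "'a \<Rightarrow> real"

definition scale :: "real \<Rightarrow> 'a vec \<Rightarrow> 'a vec" where
  "scale r v = (\<lambda>t. r * v t)"

text \<open>\<open>V\<close> is realized as the functions supported on \<open>S\<close>, with basis \<open>\<alpha> s\<close>. Since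
  \<open>form (\<alpha> s) (\<alpha> s) = 1\<close>, the elements of \<open>\<Delta>\<close> are unit vectors; they index the generators
  and give the coefficients of the Chevalley and Dunkl elements. The crystallographic
  normalization is a separate choice of lengths, \<open>c s\<close> being the length given to
  \<open>\<alpha> s\<close>. It matters for no relation except the side condition
  \<open>l(s\<^sub>\<gamma>) \<noteq> 2 (\<rho>, \<gamma>\<^sup>\<or>) - 1\<close> of the four-term relations.

  The coefficients of the Chevalley elements must be taken with roots of equal length: in
  type \<open>B\<^sub>2\<close>, with \<open>\<gamma>\<^sub>0, \<dots>, \<gamma>\<^sub>3\<close> equal to
  \<open>e\<^sub>1 - e\<^sub>2, e\<^sub>1, e\<^sub>1 + e\<^sub>2, e\<^sub>2\<close> and coroots computed from these lengths, the commutator of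
  the two Chevalley elements is a nonzero multiple of \<open>[\<gamma>\<^sub>1][\<gamma>\<^sub>3] - [\<gamma>\<^sub>3][\<gamma>\<^sub>1]\<close>, and this
  is not a consequence of the relations, which in degree two only give
  \<open>[\<gamma>\<^sub>0][\<gamma>\<^sub>2] - [\<gamma>\<^sub>2][\<gamma>\<^sub>0] + [\<gamma>\<^sub>1][\<gamma>\<^sub>3] - [\<gamma>\<^sub>3][\<gamma>\<^sub>1] = 0\<close> for these two pairs.\<close>

locale coxeter_data =
  fixes W :: "('a, 'b) monoid_scheme" (structure)
    and S :: "'a set"
    and c :: "'a \<Rightarrow> real"
begin

definition V :: "'a vec set" where
  "V = {v. \<forall>t. t \<notin> S \<longrightarrow> v t = 0}"

definition simple_root :: "'a \<Rightarrow> 'a vec" ("\<alpha>") where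
  "\<alpha> s = (\<lambda>t. if t = s then 1 else 0)"

definition form :: "'a vec \<Rightarrow> 'a vec \<Rightarrow> real" where
  "form u v = (\<Sum>s\<in>S. \<Sum>t\<in>S. u s * v t * (- cos (pi / real (coxeter_m W s t))))"

definition coroot :: "'a vec \<Rightarrow> 'a vec" where
  "coroot \<gamma> = scale (2 / form \<gamma> \<gamma>) \<gamma>"

definition reflection :: "'a vec \<Rightarrow> 'a vec \<Rightarrow> 'a vec" where
  "reflection \<gamma> v = v - scale (form v (coroot \<gamma>)) \<gamma>"

definition gen_act :: "'a \<Rightarrow> 'a vec \<Rightarrow> 'a vec" where
  "gen_act s v = v - scale (2 * form (\<alpha> s) v) (\<alpha> s)"

text \<open>In a Coxeter system the action does not depend on the chosen word, since the
  reflections \<^term>\<open>gen_act s\<close> satisfy the defining relations.\<close>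

definition act :: "'a \<Rightarrow> 'a vec \<Rightarrow> 'a vec" where
  "act w = foldr gen_act (SOME ws. ws \<in> lists S \<and> word_prod W ws = w)"

definition len :: "'a \<Rightarrow> nat" where
  "len w = (LEAST n. \<exists>ws\<in>lists S. length ws = n \<and> word_prod W ws = w)"

definition roots :: "'a vec set" ("\<Delta>") where
  "\<Delta> = {act w (\<alpha> s) | w s. w \<in> carrier W \<and> s \<in> S}"

definition pos_roots :: "'a vec set" ("\<Delta>\<^sub>+") where
  "\<Delta>\<^sub>+ = {\<gamma> \<in> \<Delta>. \<forall>s\<in>S. 0 \<le> \<gamma> s}"

definition crystallographic :: bool where
  "crystallographic \<longleftrightarrow> (\<forall>s\<in>S. \<forall>t\<in>S. s \<noteq> t \<longrightarrow> coxeter_m W s t \<in> {2, 3, 4, 6})"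

definition normalized_roots :: "'a vec set" where
  "normalized_roots = {act w (scale (c s) (\<alpha> s)) | w s. w \<in> carrier W \<and> s \<in> S}"

definition normalized_pos_roots :: "'a vec set" where
  "normalized_pos_roots = {\<gamma> \<in> normalized_roots. \<forall>s\<in>S. 0 \<le> \<gamma> s}"

definition normalize_root :: "'a vec \<Rightarrow> 'a vec" where
  "normalize_root \<gamma> = (THE \<delta>. \<delta> \<in> normalized_roots \<and> (\<exists>r>0. \<delta> = scale r \<gamma>))"

text \<open>The second condition makes the length of a normalized root depend only on the line
  it spans, so that the normalized root system is reduced.\<close>

definition root_normalization :: bool where
  "root_normalization \<longleftrightarrow>
     (\<forall>s\<in>S. 0 < c s) \<and>
     (\<forall>s\<in>S. \<forall>t\<in>S. (\<exists>w\<in>carrier W. w \<otimes> s \<otimes> inv w = t) \<longrightarrow> c s = c t) \<and>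
     (if crystallographic
      then \<forall>\<gamma>\<in>normalized_roots. \<forall>\<gamma>'\<in>normalized_roots. 2 * form \<gamma> \<gamma>' / form \<gamma> \<gamma> \<in> \<int>
      else \<forall>s\<in>S. c s = 1)"

text \<open>The reflection in \<open>\<gamma>\<close> as an element of \<open>W\<close>; it is unique because the action is faithful.\<close>

definition refl_elt :: "'a vec \<Rightarrow> 'a" where
  "refl_elt \<gamma> = (THE w. w \<in> carrier W \<and> (\<forall>v\<in>V. act w v = reflection \<gamma> v))"

definition rho :: "'a vec" where
  "rho = scale (1 / 2) (\<Sum>\<gamma>\<in>normalized_pos_roots. \<gamma>)"

definition fund_weight :: "'a \<Rightarrow> 'a vec" ("\<omega>") where
  "\<omega> s = (THE v. v \<in> V \<and> (\<forall>t\<in>S. form v (coroot (\<alpha> t)) = (if s = t then 1 else 0)))"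

definition root_system :: "'a vec set \<Rightarrow> bool" where
  "root_system \<Phi> \<longleftrightarrow>
     finite \<Phi> \<and> \<Phi> \<subseteq> V - {0} \<and>
     (\<forall>\<gamma>\<in>\<Phi>. \<Phi> \<inter> range (\<lambda>r. scale r \<gamma>) = {\<gamma>, - \<gamma>} \<and> reflection \<gamma> ` \<Phi> = \<Phi>)"

text \<open>The type is read off a simple system \<open>{a, b}\<close>: the product of the two simple
  reflections has order \<open>m\<close>. Root lengths are irrelevant.\<close>

definition root_system_I2 :: "nat \<Rightarrow> 'a vec set \<Rightarrow> bool" where
  "root_system_I2 m \<Phi> \<longleftrightarrow>
     root_system \<Phi> \<and>
     (\<exists>a\<in>\<Phi>. \<exists>b\<in>\<Phi>.
        b \<notin> range (\<lambda>r. scale r a) \<and>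
        (\<forall>\<gamma>\<in>\<Phi>. \<exists>x y. 0 \<le> x \<and> 0 \<le> y \<and>
            (\<gamma> = scale x a + scale y b \<or> \<gamma> = - (scale x a + scale y b))) \<and>
        0 < m \<and>
        (\<forall>v\<in>V. ((reflection a \<circ> reflection b) ^^ m) v = v) \<and>
        (\<forall>j. 0 < j \<and> j < m \<longrightarrow>
            \<not> (\<forall>v\<in>V. ((reflection a \<circ> reflection b) ^^ j) v = v)))"

text \<open>The sequence is extended by \<open>\<gamma>\<^bsub>j+m\<^esub> = -\<gamma>\<^sub>j\<close>.\<close>

definition dihedral_seq :: "nat \<Rightarrow> (nat \<Rightarrow> 'a vec) \<Rightarrow> bool" where
  "dihedral_seq m \<gamma> \<longleftrightarrow>
     2 \<le> m \<and>
     (\<forall>i<m. \<gamma> i \<in> \<Delta>\<^sub>+) \<and>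
     (\<forall>j. \<gamma> (j + m) = - \<gamma> j) \<and>
     root_system_I2 m ({\<gamma> i | i. i < m} \<union> {- \<gamma> i | i. i < m}) \<and>
     (\<forall>i. i + 2 \<le> m \<longrightarrow>
        {scale x (\<gamma> i) + scale y (\<gamma> (i + 1)) | x y. 0 \<le> x \<and> 0 \<le> y} \<inter> \<Delta>\<^sub>+
          = {\<gamma> i, \<gamma> (i + 1)})"

section \<open>The quantized bracket algebra\<close>

abbreviation free_bracket :: "('a, 'a vec) free_alg ring" where
  "free_bracket \<equiv> free_algebra S \<Delta>"

definition rel_neg :: "('a, 'a vec) free_alg set" where
  "rel_neg = {fgen (- \<gamma>) + fgen \<gamma> | \<gamma>. \<gamma> \<in> \<Delta>}"

definition rel_square :: "('a, 'a vec) free_alg set" where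
  "rel_square =
     {fgen (\<alpha> s) * fgen (\<alpha> s) - fscalar (poly_var s) | s. s \<in> S} \<union>
     {fgen \<gamma> * fgen \<gamma> | \<gamma>. \<gamma> \<in> \<Delta>\<^sub>+ \<and> \<gamma> \<notin> \<alpha> ` S}"

definition rel_quadratic :: "('a, 'a vec) free_alg set" where
  "rel_quadratic =
     {(\<Sum>i<m. fgen (\<gamma> i) * fgen (\<gamma> (i + k))) | m \<gamma> k.
        dihedral_seq m \<gamma> \<and> 1 \<le> k \<and> 2 * k \<le> m}"

definition rel_fourterm :: "('a, 'a vec) free_alg set" where
  "rel_fourterm =
     {fgen (\<gamma> k) * up + up * fgen (\<gamma> k) + fgen (\<gamma> k) * down + down * fgen (\<gamma> k) | m \<gamma> k up down.
        dihedral_seq m \<gamma> \<and> 4 \<le> m \<and> k = m div 2 - 1 \<and>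
        real (len (refl_elt (\<gamma> k))) \<noteq> 2 * form rho (coroot (normalize_root (\<gamma> k))) - 1 \<and>
        up = prod_list (map (\<lambda>i. fgen (\<gamma> i)) [0..<2 * k + 1]) \<and>
        down = prod_list (map (\<lambda>i. fgen (\<gamma> i)) (rev [0..<2 * k + 1]))}"

definition qBE_ideal :: "('a, 'a vec) free_alg set" where
  "qBE_ideal = Idl\<^bsub>free_bracket\<^esub> (rel_neg \<union> rel_square \<union> rel_quadratic \<union> rel_fourterm)"

definition qBE :: "('a, 'a vec) free_alg set ring" where
  "qBE = free_bracket Quot qBE_ideal"

definition qBE_class :: "('a, 'a vec) free_alg \<Rightarrow> ('a, 'a vec) free_alg set" where
  "qBE_class f = qBE_ideal +>\<^bsub>free_bracket\<^esub> f"

definition bracket :: "'a vec \<Rightarrow> ('a, 'a vec) free_alg set" where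
  "bracket \<gamma> = qBE_class (fgen \<gamma>)"

text \<open>The structure of an algebra over the polynomial ring \<^term>\<open>polys S\<close>.\<close>

definition qBE_smult :: "'a rpoly \<Rightarrow> ('a, 'a vec) free_alg set \<Rightarrow> ('a, 'a vec) free_alg set" where
  "qBE_smult p x = qBE_class (fscalar p) \<otimes>\<^bsub>qBE\<^esub> x"

definition quantum_chevalley :: "'a \<Rightarrow> ('a, 'a vec) free_alg set" where
  "quantum_chevalley s =
     (\<Oplus>\<^bsub>qBE\<^esub>\<gamma>\<in>\<Delta>\<^sub>+. qBE_smult (poly_const (form (\<omega> s) (coroot \<gamma>))) (bracket \<gamma>))"

definition quantum_dunkl :: "'a \<Rightarrow> ('a, 'a vec) free_alg set" where
  "quantum_dunkl s =
     (\<Oplus>\<^bsub>qBE\<^esub>t\<in>S. qBE_smult (poly_const (form (\<alpha> s) (\<alpha> t))) (quantum_chevalley t))"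

end

end

theory Submission
  imports Defs
begin

text \<open>The quantum Dunkl element of \<open>s\<close> has the form \<open>\<Sum>\<^sub>\<gamma> L(\<gamma>) [\<gamma>]\<close> with a linear functional \<open>L\<close>,
  and any two elements of this form commute. In the commutator of the elements given by \<open>L\<close> and
  \<open>M\<close> the coefficient of \<open>[\<gamma>][\<delta>]\<close> is the alternating form \<open>L(\<gamma>)M(\<delta>) - M(\<gamma>)L(\<delta>)\<close>, so the squares
  drop out. Collect the remaining pairs by the plane they span. The positive roots in such a plane
  are unit vectors \<open>\<gamma>\<^sub>0, \<dots>, \<gamma>\<^bsub>m-1\<^esub>\<close> at consecutive angles \<open>\<pi>/m\<close>, hence the coefficient of
  \<open>[\<gamma>\<^sub>i][\<gamma>\<^sub>j]\<close> is \<open>K sin((j - i)\<pi>/m)\<close> and the plane contributes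
  \<open>K \<Sum>\<^sub>k sin(k\<pi>/m) \<Sum>\<^sub>i [\<gamma>\<^sub>i][\<gamma>\<^bsub>i+k\<^esub>]\<close>, where every inner sum vanishes by the quadratic relations of
  the sequence or of its reversal.

  This needs two classical facts about finite Coxeter groups: the form is positive definite,
  and every root is a nonnegative or a nonpositive combination of simple roots.\<close>

text \<open>What allows the regrouping by k is a sign: the sine changes sign when its angle grows by
  pi, and [\<gamma>] changes sign with \<gamma>, so K sin((j - i) pi/m) [\<gamma>_i][\<gamma>_j] has
  period m in j modulo the relations. The sum over the square of indices can therefore be read along
  its diagonals j = i + k, where the sine is constant. The obstacle is geometric: quadratic
  relations are available only for sequences that satisfy \<open>dihedral_seq\<close>, so every
  plane spanned by two roots must be shown to contain one. Both classical facts serve this. Positive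
  definiteness supplies orthonormal bases, which turn the roots of a plane into angles. The sign
  property makes the sum of coordinates nonzero on roots and positive exactly on the positive ones.
  With the first basis vector in the kernel of that sum, the positive roots of the plane are those
  with angle in (0, pi), and ordering them by angle gives the sequence.\<close>

context coxeter_data
begin

section \<open>Bilinearity of the form and arithmetic of \<open>scale\<close>\<close>

lemma form_add_left: "form (u + v) w = form u w + form v w"
  and form_add_right: "form w (u + v) = form w u + form w v"
  by (simp_all only: form_def plus_fun_apply distrib_left distrib_right sum.distrib)

lemma form_scale_left [simp]: "form (scale r u) w = r * form u w"
  and form_scale_right [simp]: "form w (scale r u) = r * form w u"
  by (simp_all add: form_def scale_def sum_distrib_left algebra_simps)

lemma form_uminus_left [simp]: "form (- u) w = - form u w"
  and form_uminus_right [simp]: "form w (- u) = - form w u"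
  by (simp_all add: form_def sum_negf)

lemma form_zero_left [simp]: "form 0 w = 0"
  and form_zero_right [simp]: "form w 0 = 0"
  by (simp_all add: form_def)

lemma form_diff_left: "form (u - v) w = form u w - form v w"
  and form_diff_right: "form w (u - v) = form w u - form w v"
  using form_add_left[of u "- v" w] form_add_right[of w u "- v"] by simp_all

end

lemma scale_1 [simp]: "scale 1 v = v"
  and scale_0 [simp]: "scale 0 v = 0"
  and scale_zero [simp]: "scale r 0 = 0"
  and scale_minus_1: "scale (- 1) v = - v"
  and scale_scale [simp]: "scale r (scale t v) = scale (r * t) v"
  by (simp_all add: scale_def fun_eq_iff)

lemma scale_add: "scale r (u + v) = scale r u + scale r v"
  and scale_uminus: "scale r (- u) = - scale r u"
  and scale_uminus_left: "scale (- r) u = - scale r u"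
  by (simp_all add: scale_def fun_eq_iff algebra_simps)

lemmas vec_defs = scale_def fun_eq_iff

section \<open>The geometric representation\<close>

locale finite_coxeter_system = coxeter_data W S c
  for W :: "('a, 'b) monoid_scheme" (structure) and S :: "'a set" and c :: "'a \<Rightarrow> real" +
  assumes coxeter_system: "coxeter_system W S"
    and finite_carrier: "finite (carrier W)"
begin

sublocale group W
  using coxeter_system by (simp add: coxeter_system_def)

lemma gens_carrier: "S \<subseteq> carrier W"
  and generate_gens: "generate W S = carrier W"
  and ord_gen: "s \<in> S \<Longrightarrow> ord s = 2"
  and coxeter_equiv_Nil: "ws \<in> lists S \<Longrightarrow> word_prod W ws = \<one> \<Longrightarrow> coxeter_equiv W S ws []"
  using coxeter_system by (auto simp: coxeter_system_def)

lemma gen_closed [simp]: "s \<in> S \<Longrightarrow> s \<in> carrier W"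
  using gens_carrier by blast

lemma finite_gens [simp]: "finite S"
  using finite_subset[OF gens_carrier finite_carrier] .

lemma gen_square: "s \<in> S \<Longrightarrow> s \<otimes> s = \<one>"
  using pow_ord_eq_1[of s] ord_gen[of s] by (simp add: numeral_2_eq_2)

lemma inv_gen: "s \<in> S \<Longrightarrow> inv s = s"
  by (simp add: gen_square inv_equality)

lemma coxeter_m_commute: "s \<in> S \<Longrightarrow> t \<in> S \<Longrightarrow> coxeter_m W s t = coxeter_m W t s"
  using ord_inv[of "s \<otimes> t"] by (simp add: coxeter_m_def inv_mult_group inv_gen)

lemma coxeter_m_same: "s \<in> S \<Longrightarrow> coxeter_m W s s = 1"
  by (simp add: coxeter_m_def gen_square ord_eq_1[symmetric])

lemma coxeter_m_ge_2:
  assumes "s \<in> S" "t \<in> S" "s \<noteq> t"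
  shows "2 \<le> coxeter_m W s t"
proof -
  have "coxeter_m W s t \<noteq> 0"
    using ord_ge_1[OF finite_carrier, of "s \<otimes> t"] assms by (simp add: coxeter_m_def)
  moreover have "coxeter_m W s t \<noteq> 1"
  proof
    assume "coxeter_m W s t = 1"
    then have "s \<otimes> t = \<one>"
      using ord_eq_1[of "s \<otimes> t"] assms by (simp add: coxeter_m_def)
    then show False
      using inv_equality[of s t] assms by (simp add: inv_gen)
  qed
  ultimately show ?thesis by linarith
qed

lemma form_simple_roots:
  assumes "s \<in> S" "t \<in> S"
  shows "form (\<alpha> s) (\<alpha> t) = - cos (pi / real (coxeter_m W s t))"
proof -
  have "form (\<alpha> s) (\<alpha> t) = (\<Sum>x\<in>S. \<Sum>y\<in>S. if x = s \<and> y = t then - cos (pi / real (coxeter_m W s t)) else 0)"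
    unfolding form_def simple_root_def by (intro sum.cong) auto
  also have "\<dots> = (\<Sum>x\<in>S. if x = s then \<Sum>y\<in>S. if y = t then - cos (pi / real (coxeter_m W s t)) else 0 else 0)"
    by (intro sum.cong) auto
  finally show ?thesis using assms by simp
qed

lemma form_simple_root [simp]: "s \<in> S \<Longrightarrow> form (\<alpha> s) (\<alpha> s) = 1"
  by (simp add: form_simple_roots coxeter_m_same)

lemma form_commute: "form u v = form v u"
  unfolding form_def
  by (subst sum.swap, intro sum.cong) (auto simp: coxeter_m_commute mult_ac)

text \<open>On vectors of length 1, such as the roots in \<open>\<Delta>\<close>, this agrees with
  \<open>reflection\<close>; on simple roots also with \<open>gen_act\<close>. One formula then
  serves both.\<close>

definition unit_reflection :: "'a vec \<Rightarrow> 'a vec \<Rightarrow> 'a vec" where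
  "unit_reflection \<gamma> v = v - scale (2 * form v \<gamma>) \<gamma>"

lemma gen_act_eq_unit_reflection: "gen_act s v = unit_reflection (\<alpha> s) v"
  by (simp add: gen_act_def unit_reflection_def form_commute)

lemma reflection_eq_unit_reflection: "form \<gamma> \<gamma> = 1 \<Longrightarrow> reflection \<gamma> = unit_reflection \<gamma>"
  by (simp add: fun_eq_iff[of "reflection \<gamma>"] reflection_def unit_reflection_def coroot_def)

lemma unit_reflection_add: "unit_reflection \<gamma> (u + v) = unit_reflection \<gamma> u + unit_reflection \<gamma> v"
  and unit_reflection_scale: "unit_reflection \<gamma> (scale r u) = scale r (unit_reflection \<gamma> u)"
  unfolding unit_reflection_def form_add_left form_scale_left
  by (simp_all add: vec_defs algebra_simps)

lemma unit_reflection_isometry: "form \<gamma> \<gamma> = 1 \<Longrightarrow> form (unit_reflection \<gamma> u) (unit_reflection \<gamma> v) = form u v"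
  by (simp add: unit_reflection_def form_diff_left form_diff_right form_commute[of \<gamma> u] form_commute[of \<gamma> v] algebra_simps)

lemma unit_reflection_involution: "form \<gamma> \<gamma> = 1 \<Longrightarrow> unit_reflection \<gamma> (unit_reflection \<gamma> v) = v"
  unfolding unit_reflection_def form_diff_left form_scale_left
  by (simp add: vec_defs algebra_simps)

section \<open>Circular coordinates in a plane\<close>

definition arc :: "'a vec \<Rightarrow> 'a vec \<Rightarrow> real \<Rightarrow> 'a vec" where
  "arc e f x = scale (cos x) e + scale (sin x) f"

definition orthonormal :: "'a vec \<Rightarrow> 'a vec \<Rightarrow> bool" where
  "orthonormal e f \<longleftrightarrow> form e e = 1 \<and> form f f = 1 \<and> form e f = 0"

lemma form_arc:
  assumes "orthonormal e f"
  shows "form (arc e f x) (arc e f y) = cos (x - y)"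
  using assms
  by (simp add: orthonormal_def arc_def form_add_left form_add_right form_commute[of f e] cos_diff)

lemma arc_pi: "arc e f (x + pi) = - arc e f x" "arc e f (x - pi) = - arc e f x"
  by (simp_all add: arc_def scale_uminus_left)

lemma arc_2pi: "arc e f (x + 2 * pi * of_int n) = arc e f x"
  using sin_cos_eq_iff[of x "x + 2 * pi * of_int n"]
  by (simp add: arc_def sin_add cos_add sin_int_2pin cos_int_2pin)

text \<open>The mirror of the vector at angle y has angle y + pi/2, so within the plane x goes to 2
  (y + pi/2) - x, while the component v orthogonal to the plane is fixed. Carrying v along makes the
  order computations valid on all vectors, not only on the plane.\<close>

lemma unit_reflection_arc:
  assumes "orthonormal e f" "form v e = 0" "form v f = 0"
  shows "unit_reflection (arc e f y) (v + scale r (arc e f x)) = v + scale r (arc e f (2 * y - x + pi))"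
proof -
  have "form v (arc e f y) = 0"
    using assms(2,3) by (simp add: arc_def form_add_right)
  then have "unit_reflection (arc e f y) (v + scale r (arc e f x))
      = v + scale r (arc e f x - scale (2 * cos (x - y)) (arc e f y))"
    unfolding unit_reflection_def form_add_left form_scale_left form_arc[OF assms(1)]
    by (simp add: vec_defs algebra_simps)
  also have "arc e f x - scale (2 * cos (x - y)) (arc e f y) = arc e f (2 * y - x + pi)"
  proof -
    have c: "cos x - 2 * cos (x - y) * cos y = - cos (2 * y - x)"
      using cos_times_cos[of "x - y" y] cos_minus[of "x - 2*y"] by (simp add: algebra_simps)
    have s: "sin x - 2 * cos (x - y) * sin y = - sin (2 * y - x)"
      using sin_times_cos[of y "x - y"] by (simp add: algebra_simps)
    have "arc e f x - scale (2 * cos (x - y)) (arc e f y)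
      = scale (cos x - 2 * cos (x - y) * cos y) e + scale (sin x - 2 * cos (x - y) * sin y) f"
      by (simp add: arc_def vec_defs algebra_simps)
    also have "\<dots> = arc e f (2 * y - x + pi)"
      unfolding c s arc_def by simp
    finally show ?thesis .
  qed
  finally show ?thesis .
qed

lemma unit_reflection_arc_plane:
  "orthonormal e f \<Longrightarrow> unit_reflection (arc e f y) (arc e f x) = - arc e f (2 * y - x)"
  using unit_reflection_arc[of e f 0 y 1 x] by (simp add: arc_pi)

text \<open>Two reflections compose to the rotation by twice the angle y - z between their
  roots.\<close>

lemma funpow_unit_reflection_arc:
  assumes "orthonormal e f" "form v e = 0" "form v f = 0"
  shows "((unit_reflection (arc e f y) \<circ> unit_reflection (arc e f z)) ^^ j) (v + scale r (arc e f x))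
    = v + scale r (arc e f (x + 2 * real j * (y - z)))"
proof (induction j)
  case (Suc j)
  have "2 * y - (2 * z - (x + 2 * real j * (y - z)) + pi) + pi = x + 2 * real (Suc j) * (y - z)"
    by (simp add: algebra_simps)
  moreover have "(F ^^ Suc j) w = unit_reflection (arc e f y) (unit_reflection (arc e f z) ((F ^^ j) w))"
    if "F = unit_reflection (arc e f y) \<circ> unit_reflection (arc e f z)" for F w
    using that by simp
  ultimately show ?case by (simp only: Suc unit_reflection_arc[OF assms])
qed simp

lemma arc_decomposition:
  assumes "orthonormal e f"
  obtains u r x where "form u e = 0" "form u f = 0" "v = u + scale r (arc e f x)"
proof -
  obtain r x where rx: "form v e = r * cos x" "form v f = r * sin x"
    using polar_Ex by blast
  define u where "u = v - scale r (arc e f x)"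
  have "form u e = 0" "form u f = 0"
    using assms rx
    by (simp_all add: u_def arc_def orthonormal_def form_diff_left form_add_left form_commute[of f e])
  moreover have "v = u + scale r (arc e f x)"
    by (simp add: u_def)
  ultimately show ?thesis using that by blast
qed

lemma funpow_unit_reflection_eq_id:
  fixes y z :: real
  assumes "orthonormal e f" "real m * (y - z) = pi * of_int n"
  shows "((unit_reflection (arc e f y) \<circ> unit_reflection (arc e f z)) ^^ m) v = v"
proof -
  obtain u r x where u: "form u e = 0" "form u f = 0" "v = u + scale r (arc e f x)"
    using arc_decomposition[OF assms(1)] by blast
  have "x + 2 * real m * (y - z) = x + 2 * pi * of_int n"
    using assms(2) by (simp add: algebra_simps)
  then show ?thesis
    unfolding u(3) funpow_unit_reflection_arc[OF assms(1) u(1,2)] by (simp only: arc_2pi)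
qed

text \<open>For s \<noteq> t the simple roots enclose the angle pi - pi/m, so the product of their
  reflections is, up to full turns, a rotation by 2 pi/m.\<close>

lemma gen_act_braid:
  assumes "s \<in> S" "t \<in> S"
  shows "((gen_act s \<circ> gen_act t) ^^ coxeter_m W s t) v = v"
proof (cases "s = t")
  case True
  then show ?thesis
    using assms by (simp add: coxeter_m_same gen_act_eq_unit_reflection unit_reflection_involution)
next
  case False
  define m where "m = coxeter_m W s t"
  define x where "x = pi / real m"
  \<comment> \<open>Gram-Schmidt: the part of \<open>\<alpha> t\<close> orthogonal to
    \<open>\<alpha> s\<close> is \<open>\<alpha> t + scale (cos x) (\<alpha> s)\<close>, of length
    \<open>sin x\<close>.\<close>
  define f where "f = scale (1 / sin x) (\<alpha> t + scale (cos x) (\<alpha> s))"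
  have m: "2 \<le> m" using coxeter_m_ge_2[OF assms False] by (simp add: m_def)
  then have x: "0 < x" "x < pi" "real m * x = pi"
    by (auto simp: x_def field_simps)
  then have sx: "sin x \<noteq> 0" using sin_gt_zero[of x] by simp
  have st: "form (\<alpha> s) (\<alpha> t) = - cos x" "form (\<alpha> t) (\<alpha> s) = - cos x"
    using form_simple_roots[OF assms] by (simp_all add: x_def m_def form_commute)
  have sin2: "1 - cos x * cos x = sin x * sin x"
    using sin_squared_eq[of x] by (simp add: power2_eq_square)
  have ff: "form f f = (1 - cos x * cos x) / (sin x * sin x)"
    using assms st by (simp add: f_def form_add_left form_add_right field_simps)
  have on: "orthonormal (\<alpha> s) f"
    unfolding orthonormal_def ff using assms st sx sin2
    by (simp add: f_def form_add_right)
  have "arc (\<alpha> s) f 0 = \<alpha> s"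
    by (simp add: arc_def)
  moreover have "arc (\<alpha> s) f (pi - x) = \<alpha> t"
    using sx by (simp add: arc_def f_def vec_defs)
  ultimately have g: "gen_act s = unit_reflection (arc (\<alpha> s) f 0)" "gen_act t = unit_reflection (arc (\<alpha> s) f (pi - x))"
    by (auto simp: fun_eq_iff[of "gen_act _"] gen_act_eq_unit_reflection)
  have h: "real m * (0 - (pi - x)) = pi * of_int (1 - int m)"
    using x by (simp add: algebra_simps)
  show ?thesis
    unfolding m_def[symmetric] g by (rule funpow_unit_reflection_eq_id[OF on h])
qed

section \<open>Words and the action\<close>

lemma word_prod_Nil [simp]: "word_prod W [] = \<one>"
  and word_prod_Cons [simp]: "word_prod W (s # ws) = s \<otimes> word_prod W ws"
  by (simp_all add: word_prod_def)

lemma word_prod_closed [simp]: "ws \<in> lists S \<Longrightarrow> word_prod W ws \<in> carrier W"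
  by (induction ws) auto

lemma word_prod_append:
  "us \<in> lists S \<Longrightarrow> vs \<in> lists S \<Longrightarrow> word_prod W (us @ vs) = word_prod W us \<otimes> word_prod W vs"
  by (induction us) (simp_all add: m_assoc)

lemma rev_in_lists: "rev ws \<in> lists S \<longleftrightarrow> ws \<in> lists S"
  by (auto simp: in_lists_conv_set)

lemma word_prod_rev: "ws \<in> lists S \<Longrightarrow> word_prod W (rev ws) = inv word_prod W ws"
  by (induction ws) (simp_all add: word_prod_append rev_in_lists inv_mult_group inv_gen)

lemma word_exists:
  assumes "w \<in> carrier W"
  obtains ws where "ws \<in> lists S" "word_prod W ws = w"
proof -
  have "w \<in> generate W S" using assms generate_gens by simp
  then have "\<exists>ws\<in>lists S. word_prod W ws = w"
  proof induction
    case one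
    show ?case by (intro bexI[of _ "[]"]) auto
  next
    case (incl h)
    then show ?case by (intro bexI[of _ "[h]"]) auto
  next
    case (inv h)
    then show ?case by (intro bexI[of _ "[h]"]) (auto simp: inv_gen)
  next
    case (eng g h)
    then obtain us vs where "us \<in> lists S" "word_prod W us = g" "vs \<in> lists S" "word_prod W vs = h"
      by blast
    then show ?case by (intro bexI[of _ "us @ vs"]) (auto simp: word_prod_append)
  qed
  then show ?thesis using that by blast
qed

lemma foldr_gen_act_coxeter_equiv:
  "coxeter_equiv W S us vs \<Longrightarrow> foldr gen_act us v = foldr gen_act vs v"
proof (induction arbitrary: v rule: coxeter_equiv.induct)
  case (relator s t us vs)
  have "foldr gen_act (concat (replicate n [s, t])) x = ((gen_act s \<circ> gen_act t) ^^ n) x" for n x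
    by (induction n) auto
  then show ?case using gen_act_braid[OF relator] by simp
qed auto

lemma foldr_gen_act_rev: "ws \<in> lists S \<Longrightarrow> foldr gen_act (rev ws) (foldr gen_act ws v) = v"
  by (induction ws arbitrary: v) (auto simp: gen_act_eq_unit_reflection unit_reflection_involution)

text \<open>\<open>act\<close> picks an arbitrary word for a group element; this makes the choice
  immaterial. Here the presentation enters: \<open>rev vs @ us\<close> has product
  \<open>\<one>\<close>, hence reduces to the empty word by relators, which
  \<open>gen_act_braid\<close> respects.\<close>

lemma foldr_gen_act_cong:
  assumes "us \<in> lists S" "vs \<in> lists S" "word_prod W us = word_prod W vs"
  shows "foldr gen_act us v = foldr gen_act vs v"
proof -
  have "word_prod W (rev vs @ us) = \<one>"
    using assms by (simp add: word_prod_append word_prod_rev rev_in_lists)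
  moreover have "rev vs @ us \<in> lists S" using assms by auto
  ultimately have "foldr gen_act (rev vs @ us) v = v"
    using foldr_gen_act_coxeter_equiv[OF coxeter_equiv_Nil] by fastforce
  then have "foldr gen_act (rev (rev vs)) (foldr gen_act (rev vs) (foldr gen_act us v)) = foldr gen_act vs v"
    by simp
  moreover have "rev vs \<in> lists S" using assms by auto
  ultimately show ?thesis using foldr_gen_act_rev[of "rev vs"] by simp
qed

lemma act_word_prod:
  assumes "ws \<in> lists S"
  shows "act (word_prod W ws) v = foldr gen_act ws v"
proof -
  let ?P = "\<lambda>us. us \<in> lists S \<and> word_prod W us = word_prod W ws"
  have "?P (SOME us. ?P us)" using someI[of ?P ws] assms by blast
  then show ?thesis
    unfolding act_def using foldr_gen_act_cong[of _ ws v] assms by blast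
qed

lemma act_mult:
  assumes "x \<in> carrier W" "y \<in> carrier W"
  shows "act (x \<otimes> y) v = act x (act y v)"
proof -
  obtain us vs where "us \<in> lists S" "word_prod W us = x" "vs \<in> lists S" "word_prod W vs = y"
    using assms word_exists by metis
  then show ?thesis
    using act_word_prod[of "us @ vs" v] act_word_prod[of us] act_word_prod[of vs]
    by (auto simp: word_prod_append)
qed

lemma act_one [simp]: "act \<one> v = v"
  using act_word_prod[of "[]"] by simp

lemma act_gen: "s \<in> S \<Longrightarrow> act s v = gen_act s v"
  using act_word_prod[of "[s]"] by simp

lemma act_inv:
  assumes "x \<in> carrier W"
  shows "act x (act (inv x) v) = v" "act (inv x) (act x v) = v"
  using assms by (simp_all flip: act_mult)

lemma act_induct [consumes 1, case_names one step]:
  assumes "w \<in> carrier W" "P \<one>" "\<And>s w. s \<in> S \<Longrightarrow> w \<in> carrier W \<Longrightarrow> P w \<Longrightarrow> P (s \<otimes> w)"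
  shows "P w"
proof -
  obtain ws where "ws \<in> lists S" "word_prod W ws = w"
    using assms(1) word_exists by metis
  moreover have "ws \<in> lists S \<Longrightarrow> P (word_prod W ws)"
    by (induction ws) (simp_all add: assms(2,3))
  ultimately show ?thesis by simp
qed

lemma form_act: "w \<in> carrier W \<Longrightarrow> form (act w u) (act w v) = form u v"
  by (induction rule: act_induct) (auto simp: act_mult act_gen gen_act_eq_unit_reflection unit_reflection_isometry)

lemma act_add: "w \<in> carrier W \<Longrightarrow> act w (u + v) = act w u + act w v"
  by (induction rule: act_induct)
    (simp_all only: act_one act_mult act_gen gen_closed gen_act_eq_unit_reflection unit_reflection_add)

lemma act_scale: "w \<in> carrier W \<Longrightarrow> act w (scale r u) = scale r (act w u)"
  by (induction rule: act_induct) (auto simp: act_mult act_gen gen_act_eq_unit_reflection unit_reflection_scale)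

lemma act_uminus: "w \<in> carrier W \<Longrightarrow> act w (- u) = - act w u"
  using act_scale[of w "- 1" u] by (simp add: scale_minus_1)

lemma act_diff: "w \<in> carrier W \<Longrightarrow> act w (u - v) = act w u - act w v"
  using act_add[of w u "- v"] by (simp add: act_uminus)

lemma act_V: "w \<in> carrier W \<Longrightarrow> v \<in> V \<Longrightarrow> act w v \<in> V"
  by (induction rule: act_induct)
    (auto simp: act_mult act_gen gen_act_def V_def simple_root_def scale_def)

lemma simple_root_V: "s \<in> S \<Longrightarrow> \<alpha> s \<in> V"
  by (auto simp: simple_root_def V_def)

section \<open>Positive definiteness\<close>

lemma linear_expand:
  fixes L :: "'a vec \<Rightarrow> real"
  assumes add: "\<And>u v. L (u + v) = L u + L v" and scale: "\<And>r u. L (scale r u) = r * L u"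
    and "v \<in> V"
  shows "L v = (\<Sum>s\<in>S. v s * L (\<alpha> s))"
proof -
  have "\<forall>v. (\<forall>s. s \<notin> T \<longrightarrow> v s = 0) \<longrightarrow> L v = (\<Sum>s\<in>T. v s * L (\<alpha> s))" if "finite T" for T
    using that
  proof (induction T)
    case empty
    show ?case
    proof (intro allI impI)
      fix v :: "'a vec" assume "\<forall>s. s \<notin> {} \<longrightarrow> v s = 0"
      then have "v = scale 0 v" by (intro ext) simp
      then have "L v = 0 * L v" by (metis scale)
      then show "L v = (\<Sum>s\<in>{}. v s * L (\<alpha> s))" by simp
    qed
  next
    case (insert t T)
    show ?case
    proof (intro allI impI)
      fix v :: "'a vec" assume v: "\<forall>s. s \<notin> insert t T \<longrightarrow> v s = 0"
      have "v = v(t := 0) + scale (v t) (\<alpha> t)"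
        by (simp add: fun_eq_iff scale_def simple_root_def)
      then have "L v = L (v(t := 0)) + v t * L (\<alpha> t)"
        using add scale by metis
      also have "L (v(t := 0)) = (\<Sum>s\<in>T. (v(t := 0)) s * L (\<alpha> s))"
        using insert.IH v by (metis fun_upd_def insert_iff)
      also have "\<dots> = (\<Sum>s\<in>T. v s * L (\<alpha> s))"
        using insert.hyps by (intro sum.cong) auto
      finally show "L v = (\<Sum>s\<in>insert t T. v s * L (\<alpha> s))"
        using insert.hyps by simp
    qed
  qed
  then show ?thesis using assms(3) finite_gens by (simp add: V_def)
qed

text \<open>The coordinate dot product summed over the group: invariant by reindexing, and positive
  definite because the summand of the identity already is.\<close>

definition avg_form :: "'a vec \<Rightarrow> 'a vec \<Rightarrow> real" where
  "avg_form u v = (\<Sum>w\<in>carrier W. \<Sum>r\<in>S. act w u r * act w v r)"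

lemma avg_form_commute: "avg_form u v = avg_form v u"
  by (simp add: avg_form_def mult.commute)

lemma avg_form_add_left: "avg_form (u + v) x = avg_form u x + avg_form v x"
  unfolding avg_form_def sum.distrib[symmetric]
  by (rule sum.cong[OF HOL.refl], rule sum.cong[OF HOL.refl]) (simp add: act_add distrib_right)

lemma avg_form_scale_left: "avg_form (scale r u) x = r * avg_form u x"
proof -
  have "act w (scale r u) t = r * act w u t" if "w \<in> carrier W" for w t
    using act_scale[OF that, of r u] by (simp add: scale_def)
  then show ?thesis
    by (simp add: avg_form_def sum_distrib_left mult.assoc)
qed

lemma avg_form_diff_left: "avg_form (u - v) x = avg_form u x - avg_form v x"
  using avg_form_add_left[of u "- v" x] avg_form_scale_left[of "- 1" v x]
  by (simp add: scale_minus_1)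

lemma avg_form_gen_act:
  assumes "s \<in> S"
  shows "avg_form (gen_act s u) (gen_act s v) = avg_form u v"
  unfolding avg_form_def
proof (rule sum.reindex_bij_witness[where i = "\<lambda>w. w \<otimes> s" and j = "\<lambda>w. w \<otimes> s"])
  fix w assume w: "w \<in> carrier W"
  show "w \<otimes> s \<otimes> s = w" "w \<otimes> s \<otimes> s = w"
    using w assms by (simp_all add: m_assoc gen_square)
  show "w \<otimes> s \<in> carrier W" "w \<otimes> s \<in> carrier W"
    using w assms by simp_all
  show "(\<Sum>r\<in>S. act (w \<otimes> s) u r * act (w \<otimes> s) v r)
      = (\<Sum>r\<in>S. act w (gen_act s u) r * act w (gen_act s v) r)"
    using w assms by (simp add: act_mult act_gen)
qed

lemma avg_form_pos:
  assumes "v \<in> V" "v \<noteq> 0"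
  shows "0 < avg_form v v"
proof -
  obtain r where "v r \<noteq> 0" using assms(2) by (auto simp: fun_eq_iff)
  then have "r \<in> S" using assms(1) by (auto simp: V_def)
  have "0 < v r * v r" using \<open>v r \<noteq> 0\<close> by (auto simp: zero_less_mult_iff)
  then have "0 < (\<Sum>r\<in>S. v r * v r)"
    using \<open>r \<in> S\<close> by (intro sum_pos2[of S r]) auto
  then have "0 < (\<Sum>r\<in>S. act \<one> v r * act \<one> v r)" by simp
  then show ?thesis
    unfolding avg_form_def using finite_carrier
    by (intro sum_pos2[of "carrier W" \<one>]) (auto intro: sum_nonneg)
qed

lemma gen_act_simple_root: "s \<in> S \<Longrightarrow> gen_act s (\<alpha> s) = - \<alpha> s"
  by (simp add: gen_act_def vec_defs)

text \<open>The generator s negates \<open>\<alpha> s\<close>, so invariance gives \<open>avg_form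
  (gen_act s v) (\<alpha> s) = - avg_form v (\<alpha> s)\<close>; expanding
  \<open>gen_act s v\<close> on the left yields the equation.\<close>

lemma avg_form_simple_root:
  assumes "s \<in> S"
  shows "avg_form v (\<alpha> s) = form v (\<alpha> s) * avg_form (\<alpha> s) (\<alpha> s)"
proof -
  have "avg_form (gen_act s v) (\<alpha> s) = avg_form v (- \<alpha> s)"
    using avg_form_gen_act[OF assms, of "gen_act s v" "\<alpha> s"] assms
      unit_reflection_involution[of "\<alpha> s" v]
    by (simp add: gen_act_simple_root flip: gen_act_eq_unit_reflection)
  also have "\<dots> = - avg_form v (\<alpha> s)"
    using avg_form_scale_left[of "- 1" "\<alpha> s" v] by (simp add: scale_minus_1 avg_form_commute)
  finally show ?thesis
    by (simp add: gen_act_def avg_form_diff_left avg_form_scale_left form_commute[of v "\<alpha> s"])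
qed

text \<open>An invariant inner product differs from the form only by squared lengths \<open>d s\<close> of the
  \<open>\<alpha> s\<close>, and \<open>d s = d t\<close> unless \<open>\<alpha> s\<close> and \<open>\<alpha> t\<close> are orthogonal.\<close>

lemma form_pos:
  assumes "v \<in> V" "v \<noteq> 0"
  shows "0 < form v v"
proof -
  define d where "d = (\<lambda>s. avg_form (\<alpha> s) (\<alpha> s))"
  \<comment> \<open>With this rescaling the (s, t) summand of \<open>avg_form u u\<close> is v s * v
    t * form (\<alpha> s) (\<alpha> t) times sqrt (d t / d s), and the last factor is 1 unless the
    form vanishes.\<close>
  define u where "u = (\<lambda>s. v s / sqrt (d s))"
  have d: "0 < d s" if "s \<in> S" for s
  proof -
    have "\<alpha> s s \<noteq> 0" by (simp add: simple_root_def)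
    then have "\<alpha> s \<noteq> 0" by auto
    then show ?thesis unfolding d_def by (rule avg_form_pos[OF simple_root_V[OF that]])
  qed
  have u: "u \<in> V" using assms(1) by (simp add: V_def u_def)
  have "u \<noteq> 0"
  proof
    assume "u = 0"
    have "v s = 0" for s
      using fun_cong[OF \<open>u = 0\<close>, of s] d[of s] assms(1) by (cases "s \<in> S") (auto simp: u_def V_def)
    then show False using assms(2) by (simp add: fun_eq_iff)
  qed
  have eq: "d s = d t" if "s \<in> S" "t \<in> S" "form (\<alpha> s) (\<alpha> t) \<noteq> 0" for s t
  proof -
    have "form (\<alpha> s) (\<alpha> t) * d t = avg_form (\<alpha> s) (\<alpha> t)"
      using avg_form_simple_root[OF that(2), of "\<alpha> s"] by (simp only: d_def)
    also have "\<dots> = form (\<alpha> t) (\<alpha> s) * d s"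
      using avg_form_simple_root[OF that(1), of "\<alpha> t"] avg_form_commute[of "\<alpha> s" "\<alpha> t"]
      by (simp only: d_def)
    also have "form (\<alpha> t) (\<alpha> s) = form (\<alpha> s) (\<alpha> t)"
      by (rule form_commute)
    finally show ?thesis using that(3) by simp
  qed
  have "0 < avg_form u u" using avg_form_pos[OF u \<open>u \<noteq> 0\<close>] .
  also have "avg_form u u = (\<Sum>t\<in>S. u t * avg_form (\<alpha> t) u)"
    by (rule linear_expand[OF avg_form_add_left avg_form_scale_left u])
  also have "\<dots> = (\<Sum>t\<in>S. u t * (form u (\<alpha> t) * d t))"
    by (intro sum.cong HOL.refl) (subst avg_form_commute, simp add: avg_form_simple_root[where v = u] d_def)
  also have "\<dots> = (\<Sum>t\<in>S. \<Sum>s\<in>S. u t * u s * form (\<alpha> s) (\<alpha> t) * d t)"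
  proof (intro sum.cong HOL.refl)
    fix t
    show "u t * (form u (\<alpha> t) * d t) = (\<Sum>s\<in>S. u t * u s * form (\<alpha> s) (\<alpha> t) * d t)"
      using linear_expand[of "\<lambda>x. form x (\<alpha> t)", OF form_add_left form_scale_left u]
      by (simp add: sum_distrib_left sum_distrib_right mult_ac)
  qed
  also have "\<dots> = (\<Sum>t\<in>S. \<Sum>s\<in>S. v t * v s * form (\<alpha> s) (\<alpha> t))"
  proof (intro sum.cong HOL.refl)
    fix s t assume st: "s \<in> S" "t \<in> S"
    show "u t * u s * form (\<alpha> s) (\<alpha> t) * d t = v t * v s * form (\<alpha> s) (\<alpha> t)"
    proof (cases "form (\<alpha> s) (\<alpha> t) = 0")
      case False
      then have "d s = d t" using eq st by blast
      then show ?thesis using d[OF st(2)] by (simp add: u_def)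
    qed simp
  qed
  also have "\<dots> = (\<Sum>t\<in>S. v t * form v (\<alpha> t))"
  proof (intro sum.cong HOL.refl)
    fix t
    show "(\<Sum>s\<in>S. v t * v s * form (\<alpha> s) (\<alpha> t)) = v t * form v (\<alpha> t)"
      using linear_expand[of "\<lambda>x. form x (\<alpha> t)", OF form_add_left form_scale_left assms(1)]
      by (simp add: sum_distrib_left mult_ac)
  qed
  also have "\<dots> = form v v"
    using linear_expand[of "\<lambda>x. form v x", OF form_add_right form_scale_right assms(1)] by simp
  finally show ?thesis .
qed

section \<open>Length and positivity of roots\<close>

lemma len_word_prod: "ws \<in> lists S \<Longrightarrow> len (word_prod W ws) \<le> length ws"
  unfolding len_def by (rule Least_le) auto

lemma reduced_word:
  assumes "w \<in> carrier W"
  obtains ws where "ws \<in> lists S" "word_prod W ws = w" "length ws = len w"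
proof -
  obtain ws where "ws \<in> lists S" "word_prod W ws = w" using word_exists[OF assms] .
  then have "\<exists>n. \<exists>ws\<in>lists S. length ws = n \<and> word_prod W ws = w" by blast
  then have "\<exists>ws\<in>lists S. length ws = len w \<and> word_prod W ws = w"
    unfolding len_def by (rule LeastI_ex)
  then show ?thesis using that by blast
qed

lemma len_mult:
  assumes "x \<in> carrier W" "y \<in> carrier W"
  shows "len (x \<otimes> y) \<le> len x + len y"
proof -
  obtain us where us: "us \<in> lists S" "word_prod W us = x" "length us = len x"
    using reduced_word[OF assms(1)] .
  obtain vs where vs: "vs \<in> lists S" "word_prod W vs = y" "length vs = len y"
    using reduced_word[OF assms(2)] .
  show ?thesis
    using len_word_prod[of "us @ vs"] us vs by (simp add: word_prod_append)
qed

lemma len_gen: "s \<in> S \<Longrightarrow> len s \<le> 1"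
  using len_word_prod[of "[s]"] by simp

lemma len_inv:
  assumes "x \<in> carrier W"
  shows "len (inv x) \<le> len x"
proof -
  obtain us where us: "us \<in> lists S" "word_prod W us = x" "length us = len x"
    using reduced_word[OF assms(1)] .
  then show ?thesis
    using len_word_prod[of "rev us"] by (simp add: word_prod_rev rev_in_lists)
qed

text \<open>The word of length k that ends in t. Recursion at the right end fixes the last letter,
  the one that acts first; \<open>alternating_Suc\<close> exposes the first letter, which depends on
  the parity.\<close>

primrec alternating :: "nat \<Rightarrow> 'a \<Rightarrow> 'a \<Rightarrow> 'a list" where
  "alternating 0 s t = []"
| "alternating (Suc k) s t = alternating k t s @ [t]"

lemma alternating_Suc: "alternating (Suc k) s t = (if even k then t else s) # alternating k s t"
  by (induction k arbitrary: s t) auto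

lemma alternating_in_lists: "s \<in> S \<Longrightarrow> t \<in> S \<Longrightarrow> alternating k s t \<in> lists S"
  by (induction k arbitrary: s t) auto

lemma length_alternating [simp]: "length (alternating k s t) = k"
  by (induction k arbitrary: s t) auto

lemma alternating_split:
  assumes "s \<in> S" "t \<in> S"
  obtains xs where "xs \<in> lists S" "length xs = i" "alternating (i + j) s t = xs @ alternating j s t"
proof -
  have "\<exists>xs\<in>lists S. length xs = i \<and> alternating (i + j) s t = xs @ alternating j s t"
  proof (induction i)
    case (Suc i)
    then obtain xs where "xs \<in> lists S" "length xs = i" "alternating (i + j) s t = xs @ alternating j s t"
      by blast
    then show ?case
      using assms alternating_Suc[of "i + j" s t]
      by (intro bexI[of _ "(if even (i + j) then t else s) # xs"]) auto
  qed auto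
  then show ?thesis using that by blast
qed

lemma word_prod_alternating:
  assumes "s \<in> S" "t \<in> S"
  shows "word_prod W (alternating (2 * k) s t) = (s \<otimes> t) [^] k"
  by (induction k) (use assms in \<open>simp_all add: word_prod_append alternating_in_lists m_assoc\<close>)

text \<open>The relation (t s)^m = 1 says that the alternating word of length m ending in t,
  followed by s, is the inverse of a word of m - 1 letters. For k > m the k - m leading letters are
  carried along.\<close>

lemma len_alternating_gen:
  assumes "s \<in> S" "t \<in> S" "s \<noteq> t" "coxeter_m W s t \<le> k"
  shows "len (word_prod W (alternating k s t) \<otimes> s) \<le> k - 1"
proof -
  define m where "m = coxeter_m W s t"
  have m: "2 \<le> m" using coxeter_m_ge_2[OF assms(1-3)] by (simp add: m_def)
  define p where "p = word_prod W (alternating m s t)"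
  have p: "p \<in> carrier W" using assms by (simp add: p_def alternating_in_lists)
  obtain xs where xs: "xs \<in> lists S" "length xs = m - 1"
    "alternating (m - 1 + m) s t = xs @ alternating m s t"
    using alternating_split[OF assms(1,2)] .
  have "2 * m = Suc (m - 1 + m)" using m by simp
  then have "alternating (2 * m) t s = xs @ alternating m s t @ [s]"
    by (simp only: alternating.simps xs append_assoc)
  moreover have "word_prod W (alternating (2 * m) t s) = \<one>"
    using assms word_prod_alternating[of t s m] coxeter_m_commute[of s t]
    by (simp add: m_def coxeter_m_def)
  ultimately have "word_prod W xs \<otimes> (p \<otimes> s) = \<one>"
    using xs assms by (simp add: word_prod_append alternating_in_lists p_def)
  then have "p \<otimes> s = inv word_prod W xs"
    using inv_equality[OF inv_comm] xs p assms by simp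
  then have ps: "len (p \<otimes> s) \<le> m - 1"
    using len_inv[of "word_prod W xs"] len_word_prod[of xs] xs by simp
  obtain ys where ys: "ys \<in> lists S" "length ys = k - m"
    "alternating (k - m + m) s t = ys @ alternating m s t"
    using alternating_split[OF assms(1,2)] .
  then have "word_prod W (alternating k s t) \<otimes> s = word_prod W ys \<otimes> (p \<otimes> s)"
    using assms by (simp add: word_prod_append alternating_in_lists p_def m_def[symmetric] m_assoc)
  then have "len (word_prod W (alternating k s t) \<otimes> s) \<le> len (word_prod W ys) + len (p \<otimes> s)"
    using len_mult[of "word_prod W ys" "p \<otimes> s"] ys p assms by simp
  then show ?thesis
    using ps len_word_prod[OF ys(1)] ys(2) m assms(4) by (simp add: m_def[symmetric])
qed

text \<open>Each new letter changes one of the two coefficients by the Chebyshev recurrence sin((k +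
  2) x) = 2 cos x sin((k + 1) x) - sin(k x); the parity of k tells which of them carries the larger
  index.\<close>

lemma foldr_gen_act_alternating:
  assumes "s \<in> S" "t \<in> S" "s \<noteq> t"
  defines "x \<equiv> pi / real (coxeter_m W s t)"
  shows "foldr gen_act (alternating k s t) (\<alpha> s) =
    (if even k then scale (sin (real (k + 1) * x) / sin x) (\<alpha> s) + scale (sin (real k * x) / sin x) (\<alpha> t)
     else scale (sin (real k * x) / sin x) (\<alpha> s) + scale (sin (real (k + 1) * x) / sin x) (\<alpha> t))"
proof (induction k)
  case 0
  have "0 < x" "x < pi"
    using coxeter_m_ge_2[OF assms(1-3)] by (auto simp: x_def field_simps)
  then have "sin x \<noteq> 0" using sin_gt_zero[of x] by simp
  then show ?case by simp
next
  case (Suc k)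
  have st: "form (\<alpha> s) (\<alpha> t) = - cos x" "form (\<alpha> t) (\<alpha> s) = - cos x"
    using form_simple_roots[OF assms(1,2)] by (simp_all add: x_def form_commute)
  have s: "gen_act s (scale a (\<alpha> s) + scale b (\<alpha> t)) = scale (2 * cos x * b - a) (\<alpha> s) + scale b (\<alpha> t)"
    for a b
    unfolding gen_act_def form_add_right form_scale_right st form_simple_root[OF assms(1)]
    by (simp add: vec_defs algebra_simps)
  have t: "gen_act t (scale a (\<alpha> s) + scale b (\<alpha> t)) = scale a (\<alpha> s) + scale (2 * cos x * a - b) (\<alpha> t)"
    for a b
    unfolding gen_act_def form_add_right form_scale_right st form_simple_root[OF assms(2)]
    by (simp add: vec_defs algebra_simps)
  have sin_eq: "2 * cos x * (sin (real (k + 1) * x) / sin x) - sin (real k * x) / sin x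
      = sin (real (Suc k + 1) * x) / sin x"
  proof -
    have "2 * cos x * sin (real (k + 1) * x) = sin (real (k + 1) * x + x) + sin (real (k + 1) * x - x)"
      unfolding sin_add sin_diff by simp
    also have "\<dots> = sin (real (Suc k + 1) * x) + sin (real k * x)"
      by (simp add: algebra_simps)
    finally have "2 * cos x * sin (real (k + 1) * x) / sin x
        = (sin (real (Suc k + 1) * x) + sin (real k * x)) / sin x"
      by (rule arg_cong)
    then show ?thesis by (simp only: add_divide_distrib times_divide_eq_right)
  qed
  show ?case
    by (cases "even k") (simp_all only: alternating_Suc foldr.simps o_apply Suc if_True if_False
        even_Suc not_not s t sin_eq[unfolded Suc_eq_plus1[symmetric]] Suc_eq_plus1[symmetric] simp_thms)
qed

text \<open>Induction on the length: write \<open>w\<close> reduced as \<open>v\<close> times an alternating word in \<open>s\<close> and \<open>t\<close>,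
  taking that word as long as possible. Then neither \<open>s\<close> nor \<open>t\<close> shortens \<open>v\<close>, and the alternating
  word, being shorter than \<open>m(s,t)\<close>, maps \<open>\<alpha> s\<close> to a nonnegative combination of \<open>\<alpha> s\<close> and \<open>\<alpha> t\<close>.\<close>

lemma act_simple_root_nonneg:
  assumes "w \<in> carrier W" "s \<in> S" "len w \<le> len (w \<otimes> s)" "r \<in> S"
  shows "0 \<le> act w (\<alpha> s) r"
  using assms(1-3)
proof (induction "len w" arbitrary: w s rule: less_induct)
  case less
  note w = less.prems(1) and s = less.prems(2)
  obtain ws where ws: "ws \<in> lists S" "word_prod W ws = w" "length ws = len w"
    using reduced_word[OF w] .
  show ?case
  proof (cases ws rule: rev_cases)
    case Nil
    then have "w = \<one>" using ws by simp
    then show ?thesis by (simp add: simple_root_def)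
  next
    case (snoc us t)
    have us: "us \<in> lists S" and t: "t \<in> S" using ws snoc by auto
    have wt: "w = word_prod W us \<otimes> t"
      using ws(2) us t by (simp add: snoc word_prod_append)
    have len_us: "len (word_prod W us) < len w"
      using len_word_prod[OF us] ws(3) snoc by simp
    have "w \<otimes> t = word_prod W us"
      using us t by (simp add: wt m_assoc gen_square)
    then have "s \<noteq> t" using len_us less.prems(3) by auto
    \<comment> \<open>The lengths of alternating right factors ending in t that split off with
      lengths adding up; the last letter of the reduced word shows 1 \<in> K.\<close>
    define K where "K = {k. \<exists>v\<in>carrier W. w = v \<otimes> word_prod W (alternating k s t) \<and> len v + k = len w}"
    have "len w \<le> len (word_prod W us) + 1"
      using len_mult[of "word_prod W us" t] len_gen[OF t] us t by (simp add: wt)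
    then have "1 \<in> K"
      unfolding K_def using us t wt len_us
      by (intro CollectI bexI[of _ "word_prod W us"]) auto
    have "finite K"
      by (rule finite_subset[of _ "{..len w}"]) (auto simp: K_def)
    define k where "k = Max K"
    have "k \<in> K" using Max_in[OF \<open>finite K\<close>] \<open>1 \<in> K\<close> by (auto simp: k_def)
    have "1 \<le> k" using Max_ge[OF \<open>finite K\<close> \<open>1 \<in> K\<close>] by (simp add: k_def)
    have "Suc k \<notin> K" using Max_ge[OF \<open>finite K\<close>, of "Suc k"] by (auto simp: k_def)
    obtain v where v: "v \<in> carrier W" "w = v \<otimes> word_prod W (alternating k s t)" "len v + k = len w"
      using \<open>k \<in> K\<close> by (auto simp: K_def)
    define m where "m = coxeter_m W s t"
    \<comment> \<open>From m on, \<open>len_alternating_gen\<close> would make w s shorter than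
      w.\<close>
    have "k < m"
    proof (rule ccontr)
      assume "\<not> k < m"
      then have "len (word_prod W (alternating k s t) \<otimes> s) \<le> k - 1"
        using len_alternating_gen[OF s t \<open>s \<noteq> t\<close>] by (simp add: m_def)
      moreover have "w \<otimes> s = v \<otimes> (word_prod W (alternating k s t) \<otimes> s)"
        using v s t by (simp add: m_assoc alternating_in_lists)
      ultimately have "len (w \<otimes> s) \<le> len v + (k - 1)"
        using len_mult[of v "word_prod W (alternating k s t) \<otimes> s"] v(1) s t
        by (simp add: alternating_in_lists)
      then show False using less.prems(3) v(3) \<open>1 \<le> k\<close> by simp
    qed
    obtain j where j: "k = Suc j" using \<open>1 \<le> k\<close> by (cases k) auto
    \<comment> \<open>The letter f is the first of the alternating word, and g is the one that would
      prolong it to the left. If f shortened v, then w would have a word shorter than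
      \<open>len w\<close>; if g did, the factor could be prolonged beyond the maximal k.\<close>
    define f where "f = (if even j then t else s)"
    define g where "g = (if even k then t else s)"
    have fg: "f \<in> S" "g \<in> S" "{f, g} = {s, t}" using s t by (auto simp: f_def g_def j)
    have "len v \<le> len (v \<otimes> f)"
    proof -
      have "w = (v \<otimes> f) \<otimes> word_prod W (alternating j s t)"
        using v(2) s t fg v(1) by (simp add: j alternating_Suc f_def[symmetric] m_assoc
            alternating_in_lists del: alternating.simps)
      then have "len w \<le> len (v \<otimes> f) + j"
        using len_mult[of "v \<otimes> f" "word_prod W (alternating j s t)"] v(1) fg s t
          len_word_prod[of "alternating j s t"] by (simp add: alternating_in_lists)
      then show ?thesis using v(3) j by simp
    qed
    moreover have "len v \<le> len (v \<otimes> g)"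
    proof (rule ccontr)
      assume less_g: "\<not> len v \<le> len (v \<otimes> g)"
      have "(v \<otimes> g) \<otimes> (g \<otimes> x) = v \<otimes> x" if "x \<in> carrier W" for x
      proof -
        have "(v \<otimes> g) \<otimes> (g \<otimes> x) = v \<otimes> ((g \<otimes> g) \<otimes> x)"
          using v(1) fg that by (simp add: m_assoc)
        then show ?thesis using fg that by (simp add: gen_square)
      qed
      then have w': "w = (v \<otimes> g) \<otimes> word_prod W (alternating (Suc k) s t)"
        using v(2) s t by (simp add: alternating_Suc g_def[symmetric] alternating_in_lists
            del: alternating.simps)
      then have "len w \<le> len (v \<otimes> g) + Suc k"
        using len_mult[of "v \<otimes> g" "word_prod W (alternating (Suc k) s t)"] v(1) fg s t
          len_word_prod[OF alternating_in_lists[OF s t], of "Suc k"]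
        by (simp add: alternating_in_lists del: alternating.simps)
      then have "len (v \<otimes> g) + Suc k = len w" using less_g v(3) by simp
      then have "Suc k \<in> K"
        unfolding K_def using w' v(1) fg by (intro CollectI bexI[of _ "v \<otimes> g"]) auto
      then show False using \<open>Suc k \<notin> K\<close> by blast
    qed
    ultimately have "len v \<le> len (v \<otimes> s)" "len v \<le> len (v \<otimes> t)"
      using fg(3) by (auto simp: doubleton_eq_iff)
    moreover have "len v < len w" using v(3) \<open>1 \<le> k\<close> by simp
    ultimately have nonneg: "0 \<le> act v (\<alpha> s) r" "0 \<le> act v (\<alpha> t) r"
      using less.hyps v(1) s t by blast+
    define x where "x = pi / real m"
    have x: "0 < x" "real m * x = pi" using \<open>k < m\<close> by (auto simp: x_def)
    have sin_nonneg: "0 \<le> sin (real i * x)" if "i \<le> m" for i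
    proof (rule sin_ge_zero)
      show "0 \<le> real i * x" using x by simp
      have "real i * x \<le> real m * x" using that x by (intro mult_right_mono) auto
      then show "real i * x \<le> pi" using x by simp
    qed
    \<comment> \<open>As k + 1 \<le> m, the angles k x and (k + 1) x do not exceed pi.\<close>
    have "0 \<le> sin (real k * x) / sin x" "0 \<le> sin (real (k + 1) * x) / sin x"
      using sin_nonneg[of 1] sin_nonneg[of k] sin_nonneg[of "k + 1"] \<open>k < m\<close> by auto
    moreover obtain a b where ab:
      "{a, b} = {sin (real k * x) / sin x, sin (real (k + 1) * x) / sin x}"
      "foldr gen_act (alternating k s t) (\<alpha> s) = scale a (\<alpha> s) + scale b (\<alpha> t)"
      using foldr_gen_act_alternating[OF s t \<open>s \<noteq> t\<close>, of k]
      unfolding m_def[symmetric] x_def[symmetric] by (cases "even k") auto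
    ultimately have "0 \<le> a" "0 \<le> b" by (auto simp: doubleton_eq_iff)
    have "act w (\<alpha> s) = act v (scale a (\<alpha> s) + scale b (\<alpha> t))"
      using v(1,2) s t ab(2) act_word_prod[of "alternating k s t"]
      by (simp add: act_mult alternating_in_lists)
    also have "\<dots> = scale a (act v (\<alpha> s)) + scale b (act v (\<alpha> t))"
      using v(1) by (simp only: act_add act_scale)
    finally show ?thesis
      using nonneg \<open>0 \<le> a\<close> \<open>0 \<le> b\<close> by (simp add: scale_def)
  qed
qed

section \<open>Roots\<close>

lemma rootI: "w \<in> carrier W \<Longrightarrow> s \<in> S \<Longrightarrow> act w (\<alpha> s) \<in> \<Delta>"
  by (auto simp: roots_def)

lemma rootE:
  assumes "\<gamma> \<in> \<Delta>"
  obtains w s where "w \<in> carrier W" "s \<in> S" "\<gamma> = act w (\<alpha> s)"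
  using assms by (auto simp: roots_def)

lemma finite_roots: "finite \<Delta>"
proof -
  have "\<Delta> = (\<lambda>(w, s). act w (\<alpha> s)) ` (carrier W \<times> S)"
    by (auto simp: roots_def)
  then show ?thesis using finite_carrier by simp
qed

lemma root_V: "\<gamma> \<in> \<Delta> \<Longrightarrow> \<gamma> \<in> V"
  by (auto simp: simple_root_V act_V elim!: rootE)

lemma form_root [simp]: "\<gamma> \<in> \<Delta> \<Longrightarrow> form \<gamma> \<gamma> = 1"
  by (auto simp: form_act elim!: rootE)

lemma act_gen_simple_root: "w \<in> carrier W \<Longrightarrow> s \<in> S \<Longrightarrow> act (w \<otimes> s) (\<alpha> s) = - act w (\<alpha> s)"
  by (simp add: act_mult act_gen gen_act_simple_root act_uminus)

lemma root_uminus [simp]: "- \<gamma> \<in> \<Delta> \<longleftrightarrow> \<gamma> \<in> \<Delta>"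
proof -
  have "- \<gamma> \<in> \<Delta>" if "\<gamma> \<in> \<Delta>" for \<gamma>
    using that by (auto simp flip: act_gen_simple_root intro!: rootI elim!: rootE)
  from this[of \<gamma>] this[of "- \<gamma>"] show ?thesis by auto
qed

text \<open>The reflection in \<open>act w (\<alpha> s)\<close> is the action of w s w^-1.\<close>

lemma root_unit_reflection:
  assumes "\<gamma> \<in> \<Delta>" "\<delta> \<in> \<Delta>"
  shows "unit_reflection \<gamma> \<delta> \<in> \<Delta>"
proof -
  obtain w s where ws: "w \<in> carrier W" "s \<in> S" "\<gamma> = act w (\<alpha> s)"
    using rootE[OF assms(1)] .
  obtain x t where xt: "x \<in> carrier W" "t \<in> S" "\<delta> = act x (\<alpha> t)"
    using rootE[OF assms(2)] .
  define v where "v = act (inv w) \<delta>"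
  have v: "act w v = \<delta>" using ws by (simp add: v_def act_inv)
  have "act w (gen_act s v) = \<delta> - scale (2 * form (\<alpha> s) v) \<gamma>"
    using ws v by (simp add: gen_act_def act_diff act_scale)
  also have "form (\<alpha> s) v = form \<delta> \<gamma>"
    using form_act[of w v "\<alpha> s"] ws v by (simp add: form_commute)
  finally have "unit_reflection \<gamma> \<delta> = act w (gen_act s v)"
    by (simp only: unit_reflection_def)
  also have "\<dots> = act (w \<otimes> s \<otimes> inv w \<otimes> x) (\<alpha> t)"
    using ws xt by (simp add: act_mult act_gen v_def)
  finally show ?thesis using ws xt by (simp add: rootI)
qed

text \<open>A linear functional that is positive on the positive roots and negative on the others
  (\<open>pos_root_iff\<close>, \<open>height_root_nonzero\<close>), so that positivity can be read
  from one number.\<close>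

definition height :: "'a vec \<Rightarrow> real" where
  "height v = (\<Sum>s\<in>S. v s)"

lemma height_add: "height (u + v) = height u + height v"
  and height_scale: "height (scale r u) = r * height u"
  by (simp_all add: height_def sum.distrib scale_def sum_distrib_left)

lemma height_uminus: "height (- u) = - height u"
  by (simp add: height_def sum_negf)

lemma height_diff: "height (u - v) = height u - height v"
  by (simp add: height_def sum_subtractf)

lemma pos_root_cases:
  assumes "\<gamma> \<in> \<Delta>"
  shows "\<gamma> \<in> \<Delta>\<^sub>+ \<or> - \<gamma> \<in> \<Delta>\<^sub>+"
proof -
  obtain w s where ws: "w \<in> carrier W" "s \<in> S" "\<gamma> = act w (\<alpha> s)"
    using rootE[OF assms(1)] .
  \<comment> \<open>One of w and w s is not longer than its product with s, and
    \<open>w \<otimes> s\<close> sends \<open>\<alpha> s\<close> to the negative of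
    \<open>act w (\<alpha> s)\<close>.\<close>
  consider "len w \<le> len (w \<otimes> s)" | "len (w \<otimes> s) \<le> len (w \<otimes> s \<otimes> s)"
    using ws by (force simp: m_assoc gen_square)
  then show ?thesis
  proof cases
    case 1
    then show ?thesis
      using ws assms act_simple_root_nonneg by (auto simp: pos_roots_def)
  next
    case 2
    then have "\<forall>r\<in>S. 0 \<le> act (w \<otimes> s) (\<alpha> s) r"
      using ws act_simple_root_nonneg[of "w \<otimes> s" s] by simp
    then show ?thesis
      using ws assms by (simp add: act_gen_simple_root pos_roots_def)
  qed
qed

lemma height_pos_root:
  assumes "\<gamma> \<in> \<Delta>\<^sub>+"
  shows "0 < height \<gamma>"
proof -
  have "\<gamma> \<in> \<Delta>" using assms by (simp add: pos_roots_def)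
  then have \<gamma>: "\<gamma> \<in> V" "\<forall>s\<in>S. 0 \<le> \<gamma> s" "form \<gamma> \<gamma> \<noteq> 0"
    using assms root_V by (auto simp: pos_roots_def)
  then have "\<gamma> \<noteq> 0" using form_zero_left by metis
  then obtain s where "\<gamma> s \<noteq> 0" by (auto simp: fun_eq_iff)
  moreover from this have "s \<in> S" using \<gamma>(1) by (auto simp: V_def)
  ultimately show ?thesis
    unfolding height_def using \<gamma>(2) by (intro sum_pos2[of S s]) (auto simp: less_le)
qed

lemma pos_root_iff: "\<gamma> \<in> \<Delta>\<^sub>+ \<longleftrightarrow> \<gamma> \<in> \<Delta> \<and> 0 < height \<gamma>"
  using pos_root_cases[of \<gamma>] height_pos_root[of \<gamma>] height_pos_root[of "- \<gamma>"]
  by (auto simp: pos_roots_def height_uminus)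

lemma height_root_nonzero: "\<gamma> \<in> \<Delta> \<Longrightarrow> height \<gamma> \<noteq> 0"
  using pos_root_cases[of \<gamma>] height_pos_root[of \<gamma>] height_pos_root[of "- \<gamma>"]
  by (auto simp: height_uminus)

section \<open>Roots in a plane\<close>

definition plane :: "'a vec \<Rightarrow> 'a vec \<Rightarrow> 'a vec set" where
  "plane u v = {scale x u + scale y v | x y. True}"

lemma planeI: "scale x u + scale y v \<in> plane u v"
  unfolding plane_def by blast

lemma arc_in_plane: "arc e f x \<in> plane e f"
  by (simp add: arc_def planeI)

text \<open>Cramer's rule, with \<open>sin (y - x)\<close> as the determinant of the two arcs. The
  coefficients are nonnegative when x \<le> z \<le> y and y < x + pi.\<close>

lemma arc_combination:
  assumes "sin (y - x) \<noteq> 0"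
  shows "arc e f z = scale (sin (y - z) / sin (y - x)) (arc e f x) + scale (sin (z - x) / sin (y - x)) (arc e f y)"
proof -
  let ?s = "sin (y - x)"
  have "sin (y - z) * cos x + sin (z - x) * cos y = ?s * cos z"
    unfolding sin_diff by (simp only: algebra_simps)
  then have c: "cos z = (sin (y - z) * cos x + sin (z - x) * cos y) / ?s"
    using assms by simp
  have "sin (y - z) * sin x + sin (z - x) * sin y = ?s * sin z"
    unfolding sin_diff by (simp only: algebra_simps)
  then have s: "sin z = (sin (y - z) * sin x + sin (z - x) * sin y) / ?s"
    using assms by simp
  show ?thesis
    unfolding arc_def[of e f z] c s unfolding arc_def
    by (simp add: vec_defs add_divide_distrib algebra_simps)
qed

lemma plane_subset:
  assumes "u \<in> plane e f" "v \<in> plane e f"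
  shows "plane u v \<subseteq> plane e f"
proof
  fix w assume "w \<in> plane u v"
  then obtain a b where w: "w = scale a u + scale b v" by (auto simp: plane_def)
  obtain p q r t where uv: "u = scale p e + scale q f" "v = scale r e + scale t f"
    using assms by (auto simp: plane_def)
  have "w = scale (a * p + b * r) e + scale (a * q + b * t) f"
    by (simp add: w uv vec_defs algebra_simps)
  then show "w \<in> plane e f" using planeI by simp
qed

lemma plane_arc:
  assumes "sin (y - x) \<noteq> 0"
  shows "plane (arc e f x) (arc e f y) = plane e f"
proof
  show "plane (arc e f x) (arc e f y) \<subseteq> plane e f"
    by (intro plane_subset arc_in_plane)
  have "arc e f z \<in> plane (arc e f x) (arc e f y)" for z
    by (subst arc_combination[OF assms]) (rule planeI)
  from this[of 0] this[of "pi / 2"] show "plane e f \<subseteq> plane (arc e f x) (arc e f y)"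
    by (intro plane_subset) (simp_all add: arc_def)
qed

lemma arc_sin_eq_0:
  assumes "sin (y - x) = 0"
  shows "arc e f y = arc e f x \<or> arc e f y = - arc e f x"
proof -
  have "cos (y - x) = 1 \<or> cos (y - x) = - 1"
    using sin_cos_squared_add[of "y - x"] assms by (simp add: power2_eq_1_iff)
  moreover have "cos y = cos x * cos (y - x)" "sin y = sin x * cos (y - x)"
    using cos_add[of x "y - x"] sin_add[of x "y - x"] assms by simp_all
  ultimately show ?thesis
    by (auto simp: arc_def vec_defs)
qed

text \<open>With e in the kernel of \<open>height\<close>, the height of an arc is the sine of its
  angle times a positive constant, so the positive roots of the plane lie on the open upper half
  circle.\<close>

definition adapted :: "'a vec \<Rightarrow> 'a vec \<Rightarrow> bool" where
  "adapted e f \<longleftrightarrow> orthonormal e f \<and> e \<in> V \<and> f \<in> V \<and> height e = 0 \<and> 0 < height f"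

lemma adapted_orthonormal: "adapted e f \<Longrightarrow> orthonormal e f"
  by (simp add: adapted_def)

lemma height_arc: "adapted e f \<Longrightarrow> height (arc e f x) = sin x * height f"
  by (simp add: adapted_def arc_def height_add height_scale)

lemma pos_root_arc_iff:
  "adapted e f \<Longrightarrow> arc e f x \<in> \<Delta>\<^sub>+ \<longleftrightarrow> arc e f x \<in> \<Delta> \<and> 0 < sin x"
  by (auto simp: pos_root_iff height_arc zero_less_mult_iff) (auto simp: adapted_def)

lemma root_in_plane_arc:
  assumes "orthonormal e f" "\<gamma> \<in> plane e f" "\<gamma> \<in> \<Delta>"
  obtains x where "0 \<le> x" "x < 2 * pi" "\<gamma> = arc e f x"
proof -
  obtain p q where \<gamma>: "\<gamma> = scale p e + scale q f"
    using assms(2) by (auto simp: plane_def)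
  have "form \<gamma> \<gamma> = p\<^sup>2 + q\<^sup>2"
    using assms(1)
    by (simp add: \<gamma> orthonormal_def form_add_left form_add_right form_commute[of f e] power2_eq_square)
  then have "p\<^sup>2 + q\<^sup>2 = 1" using assms(3) by simp
  then obtain x where "0 \<le> x" "x < 2 * pi" "p = cos x" "q = sin x"
    using sincos_total_2pi by blast
  then show ?thesis using that by (simp add: \<gamma> arc_def)
qed

lemma pos_root_in_plane_arc:
  assumes "adapted e f" "\<gamma> \<in> plane e f" "\<gamma> \<in> \<Delta>\<^sub>+"
  obtains x where "0 < x" "x < pi" "\<gamma> = arc e f x"
proof -
  have "\<gamma> \<in> \<Delta>" using assms(3) by (simp add: pos_root_iff)
  then obtain x where x: "0 \<le> x" "x < 2 * pi" "\<gamma> = arc e f x"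
    using root_in_plane_arc[OF adapted_orthonormal[OF assms(1)] assms(2)] by blast
  have "0 < sin x" using assms(3) pos_root_arc_iff[OF assms(1)] x(3) by simp
  then have "0 < x" "x < pi"
    using x sin_le_zero[of x] by (auto simp: less_le intro: ccontr)
  then show ?thesis using that x by blast
qed

text \<open>Gram-Schmidt, started with the combination k of the two roots whose heights cancel. It
  is nonzero because proportional positive roots, having length 1, coincide, and
  \<open>form_pos\<close> permits normalizing it. Subtracting a multiple of e from \<delta> leaves
  its height unchanged, hence positive.\<close>

lemma adapted_basis:
  assumes "\<gamma> \<in> \<Delta>\<^sub>+" "\<delta> \<in> \<Delta>\<^sub>+" "\<gamma> \<noteq> \<delta>"
  obtains e f where "adapted e f" "\<gamma> \<in> plane e f" "\<delta> \<in> plane e f"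
proof -
  have roots: "\<gamma> \<in> \<Delta>" "\<delta> \<in> \<Delta>" and h: "0 < height \<gamma>" "0 < height \<delta>"
    using assms by (auto simp: pos_root_iff)
  define k where "k = scale (height \<delta>) \<gamma> - scale (height \<gamma>) \<delta>"
  have \<gamma>: "\<gamma> = scale (1 / height \<delta>) k + scale (height \<gamma> / height \<delta>) \<delta>"
    using h by (simp add: k_def vec_defs field_simps)
  have "k \<noteq> 0"
  proof
    assume "k = 0"
    then have \<gamma>': "\<gamma> = scale (height \<gamma> / height \<delta>) \<delta>" using \<gamma> by simp
    then have "form \<gamma> \<gamma> = (height \<gamma> / height \<delta>)\<^sup>2 * form \<delta> \<delta>"
      by (metis form_scale_left form_scale_right mult.assoc power2_eq_square)
    then have "height \<gamma> / height \<delta> = 1"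
      using roots divide_pos_pos[OF h] power2_eq_1_iff[of "height \<gamma> / height \<delta>"] by simp
    then show False using \<gamma>' assms(3) by simp
  qed
  have V: "x \<in> V \<Longrightarrow> y \<in> V \<Longrightarrow> x - y \<in> V" "x \<in> V \<Longrightarrow> scale r x \<in> V" for x y :: "'a vec" and r
    by (simp_all add: V_def scale_def)
  have "k \<in> V" using roots root_V V by (simp add: k_def)
  define e where "e = scale (1 / sqrt (form k k)) k"
  have k: "0 < form k k" using form_pos[OF \<open>k \<in> V\<close> \<open>k \<noteq> 0\<close>] .
  have e: "form e e = 1" "e \<in> V" "height e = 0" "k = scale (sqrt (form k k)) e"
    using k V(2) \<open>k \<in> V\<close>
    by (simp_all add: e_def height_scale) (simp add: k_def height_scale height_diff)
  define l where "l = \<delta> - scale (form \<delta> e) e"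
  have l: "height l = height \<delta>" "l \<in> V" "form l e = 0"
    using e(1-3) V roots root_V by (simp_all add: l_def height_diff height_scale form_diff_left)
  have "l \<noteq> 0" using l(1) h(2) by (auto simp: height_def)
  then have ll: "0 < form l l" using form_pos l(2) by blast
  define f where "f = scale (1 / sqrt (form l l)) l"
  have f: "form f f = 1" "f \<in> V" "0 < height f" "form e f = 0" "l = scale (sqrt (form l l)) f"
    using ll V(2) l h by (simp_all add: f_def height_scale form_commute[of e l])
  have \<delta>: "\<delta> = scale (form \<delta> e) e + scale (sqrt (form l l)) f"
    using f(5) by (simp add: l_def[symmetric] f(5)[symmetric]) (simp add: l_def)
  then have "\<delta> \<in> plane e f" using planeI by metis
  moreover have "k \<in> plane e f"
    using e(4) planeI[of "sqrt (form k k)" e 0 f] by simp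
  then have "\<gamma> \<in> plane e f"
    using plane_subset[OF \<open>k \<in> plane e f\<close> \<open>\<delta> \<in> plane e f\<close>] \<gamma> planeI by (metis subsetD)
  moreover have "adapted e f"
    using e f by (simp add: adapted_def orthonormal_def)
  ultimately show ?thesis using that by blast
qed

text \<open>The angles of the roots form a progression with step pi/m and smallest positive term b.
  No root has angle 0, where the height vanishes; hence b < pi/m is strict, and the terms 0, ..., m
  - 1 are exactly the angles in (0, pi).\<close>

definition root_angles :: "'a vec \<Rightarrow> 'a vec \<Rightarrow> real \<Rightarrow> nat \<Rightarrow> bool" where
  "root_angles e f b m \<longleftrightarrow>
     adapted e f \<and> 2 \<le> m \<and> 0 < b \<and> b < pi / real m \<and>
     (\<forall>x. arc e f x \<in> \<Delta> \<longleftrightarrow> (\<exists>n::int. x = b + of_int n * (pi / real m)))"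

text \<open>On a half-open turn the vector determines the angle, so finitely many roots give
  finitely many angles.\<close>

lemma finite_root_arcs:
  assumes "orthonormal e f"
  shows "finite {x. arc e f x \<in> \<Delta> \<and> l \<le> x \<and> x < l + 2 * pi}"
proof (rule finite_imageD)
  show "finite (arc e f ` {x. arc e f x \<in> \<Delta> \<and> l \<le> x \<and> x < l + 2 * pi})"
    by (rule finite_subset[OF _ finite_roots]) auto
  show "inj_on (arc e f) {x. arc e f x \<in> \<Delta> \<and> l \<le> x \<and> x < l + 2 * pi}"
  proof (rule inj_onI, clarify)
    fix x y assume xy: "l \<le> x" "x < l + 2 * pi" "l \<le> y" "y < l + 2 * pi" "arc e f x = arc e f y"
    have "cos (x - y) = 1"
      using form_arc[OF assms, of x y] form_arc[OF assms, of y y] xy(5) by simp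
    then obtain n :: int where n: "x - y = of_int n * (2 * pi)"
      using cos_one_2pi_int by auto
    then have "\<bar>of_int n * (2 * pi)\<bar> < 1 * (2 * pi)" using xy by auto
    then have "\<bar>real_of_int n\<bar> * (2 * pi) < 1 * (2 * pi)" by (simp add: abs_mult)
    then have "\<bar>real_of_int n\<bar> < 1" by (rule mult_right_less_imp_less) simp
    then have "n = 0" by linarith
    then show "x = y" using n by simp
  qed
qed

text \<open>The set of angles of roots is discrete and stable under reflection in each of its points,
  hence an arithmetic progression.\<close>

lemma root_angles_exist:
  assumes ef: "adapted e f" and xy: "arc e f x0 \<in> \<Delta>" "arc e f y0 \<in> \<Delta>" "0 < x0" "x0 < pi"
    "0 < y0" "y0 < pi" "x0 \<noteq> y0"
  obtains b m where "root_angles e f b m"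
proof -
  have on: "orthonormal e f" using ef by (rule adapted_orthonormal)
  define B where "B = {x. arc e f x \<in> \<Delta>}"
  \<comment> \<open>The reflected root is minus the arc at angle 2 z - x, and negatives of roots are
    roots.\<close>
  have B_refl: "2 * z - x \<in> B" if "x \<in> B" "z \<in> B" for x z
    using root_unit_reflection[of "arc e f z" "arc e f x"] that by (simp add: B_def unit_reflection_arc_plane[OF on])
  have B_pi: "x + pi \<in> B" if "x \<in> B" for x
    using that by (simp add: B_def arc_pi)
  have fin: "finite {x\<in>B. l < x \<and> x \<le> l + pi}" for l
    by (rule finite_subset[OF _ finite_root_arcs[OF on, of l]]) (auto simp: B_def)
  define B0 where "B0 = {x\<in>B. 0 < x \<and> x \<le> pi}"
  have B0: "finite B0" "x0 \<in> B0" "y0 \<in> B0"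
    using fin[of 0] xy by (auto simp: B0_def B_def)
  define b where "b = Min B0"
  have "b \<in> B0" using Min_in[OF B0(1)] B0(2) by (auto simp: b_def)
  then have b: "b \<in> B" "0 < b" by (auto simp: B0_def)
  have b_min: "b \<le> x" if "x \<in> B" "0 < x" for x
  proof (cases "x \<le> pi")
    case True
    then show ?thesis using that Min_le[OF B0(1), of x] by (simp add: b_def B0_def)
  next
    case False
    then show ?thesis using \<open>b \<in> B0\<close> by (simp add: B0_def)
  qed
  \<comment> \<open>The step d of the progression will be the gap from b to the next angle; such an
    angle exists because b + pi is one.\<close>
  define C where "C = {x\<in>B. b < x \<and> x \<le> b + pi}"
  have C: "finite C" "b + pi \<in> C" using fin[of b] B_pi[OF b(1)] by (auto simp: C_def)
  define d where "d = Min C - b"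
  have "b + d \<in> C" using Min_in[OF C(1)] C(2) by (auto simp: d_def)
  then have d: "0 < d" "d \<le> pi" "b + d \<in> B" by (auto simp: C_def)
  have d_min: "b + d \<le> x" if "x \<in> B" "b < x" for x
  proof (cases "x \<le> b + pi")
    case True
    then show ?thesis using that Min_le[OF C(1), of x] by (simp add: d_def C_def)
  next
    case False
    then show ?thesis using d(2) by simp
  qed
  have nat_mem: "b + real n * d \<in> B \<and> b + real (Suc n) * d \<in> B" for n
  proof (induction n)
    case (Suc n)
    then have "2 * (b + real (Suc n) * d) - (b + real n * d) \<in> B" using B_refl by blast
    then have "b + real (Suc (Suc n)) * d \<in> B" by (simp add: algebra_simps)
    then show ?case using Suc by blast
  qed (use b d in auto)
  have int_mem: "b + of_int n * d \<in> B" for n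
  proof (cases "0 \<le> n")
    case True
    then show ?thesis using nat_mem[of "nat n"] by simp
  next
    case False
    then have "2 * b - (b + real (nat (- n)) * d) \<in> B"
      using nat_mem[of "nat (- n)"] B_refl b(1) by blast
    then show ?thesis using False by (simp add: algebra_simps)
  qed
  have mem_int: "\<exists>n::int. x = b + of_int n * d" if "x \<in> B" for x
  proof -
    define n where "n = \<lfloor>(x - b) / d\<rfloor>"
    define r where "r = x - b - of_int n * d"
    have "of_int n \<le> (x - b) / d" "(x - b) / d < of_int n + 1"
      unfolding n_def by linarith+
    then have r: "0 \<le> r" "r < d"
      using d(1) by (simp_all add: r_def field_simps)
    have "r = 0"
    proof (rule ccontr)
      assume "r \<noteq> 0"
      then have "0 < r" using r by simp
      \<comment> \<open>Pairs of point reflections translate by even multiples of d, which moves x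
        to b + r for even n; for odd n a single reflection moves it to b + (d - r). Either point
        lies strictly between b and b + d.\<close>
      have "b + r \<in> B \<or> b + (d - r) \<in> B"
      proof (cases "even n")
        case True
        then obtain k where k: "n = 2 * k" by blast
        have "2 * (b + of_int (- k) * d) - (2 * b - x) \<in> B"
          using B_refl[OF B_refl[OF that b(1)] int_mem[of "- k"]] .
        then show ?thesis by (simp add: r_def k algebra_simps)
      next
        case False
        then obtain k where k: "n = 2 * k + 1" by (rule oddE)
        have "2 * (b + of_int (k + 1) * d) - x \<in> B"
          using B_refl[OF that int_mem[of "k + 1"]] .
        then show ?thesis by (simp add: r_def k algebra_simps)
      qed
      then show False
        using d_min[of "b + r"] d_min[of "b + (d - r)"] r \<open>0 < r\<close> by auto
    qed
    then show ?thesis by (auto simp: r_def intro: exI[of _ n])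
  qed
  \<comment> \<open>As b + pi is an angle, pi is a multiple of the step; the quotient is the m of
    the dihedral type.\<close>
  obtain n where n: "pi = of_int n * d" using mem_int[OF B_pi[OF b(1)]] by auto
  have "0 < n"
  proof (rule ccontr)
    assume "\<not> 0 < n"
    then have "of_int n * d \<le> 0" using d(1) by (simp add: mult_nonpos_nonneg)
    then show False using n pi_gt_zero by linarith
  qed
  define m where "m = nat n"
  have m: "0 < m" "d = pi / real m" using \<open>0 < n\<close> n by (simp_all add: m_def field_simps)
  \<comment> \<open>Step pi would leave a single angle in (0, pi), but x0 and y0 are two.\<close>
  have "m \<noteq> 1"
  proof
    assume "m = 1"
    then have "d = pi" using m by simp
    have "x = b" if "arc e f x \<in> \<Delta>" "0 < x" "x < pi" for x
    proof -
      have "x \<in> B" using that by (simp add: B_def)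
      then obtain k where k: "x = b + of_int k * pi" using mem_int \<open>d = pi\<close> by blast
      have "b \<le> x" using b_min that by (simp add: B_def)
      then have k0: "0 \<le> of_int k * pi" and k1: "of_int k * pi < 1 * pi" using k b(2) that(3) by linarith+
      have "real_of_int k < 1" using k1 by (rule mult_right_less_imp_less) simp
      moreover have "0 \<le> real_of_int k" using k0 pi_gt_zero by (simp add: zero_le_mult_iff)
      ultimately have "k = 0" by linarith
      then show ?thesis using k by simp
    qed
    then show False using xy by metis
  qed
  \<comment> \<open>Otherwise b - d \<ge> 0 is an angle, which must be 0 by minimality of b, and
    there would be a root of height 0.\<close>
  have "b < d"
  proof (rule ccontr)
    assume "\<not> b < d"
    have "b - d \<in> B" using int_mem[of "- 1"] by simp
    then have "b = d" using b_min[of "b - d"] d(1) \<open>\<not> b < d\<close> by fastforce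
    then have "arc e f 0 \<in> \<Delta>" using \<open>b - d \<in> B\<close> by (simp add: B_def)
    then show False using height_root_nonzero[of "arc e f 0"] height_arc[OF ef, of 0] by simp
  qed
  have "root_angles e f b m"
    unfolding root_angles_def m(2)[symmetric]
    using ef m(1) \<open>m \<noteq> 1\<close> b(2) \<open>b < d\<close> mem_int int_mem by (auto simp: B_def)
  then show ?thesis using that by blast
qed

text \<open>Defined for every i: from m on the arc runs into the lower half circle, which is the
  extension \<open>\<gamma> (j + m) = - \<gamma> j\<close> demanded by
  \<open>dihedral_seq\<close>.\<close>

definition root_at :: "'a vec \<Rightarrow> 'a vec \<Rightarrow> real \<Rightarrow> nat \<Rightarrow> nat \<Rightarrow> 'a vec" where
  "root_at e f b m i = arc e f (b + real i * (pi / real m))"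

lemma root_angles_bounds:
  assumes "root_angles e f b m" "i < m"
  shows "0 < b + real i * (pi / real m)" "b + real i * (pi / real m) < pi"
proof -
  have m: "2 \<le> m" "0 < b" "b < pi / real m" using assms(1) by (auto simp: root_angles_def)
  have "0 \<le> real i * (pi / real m)" by simp
  then show "0 < b + real i * (pi / real m)" using m by linarith
  have "real i * (pi / real m) \<le> (real m - 1) * (pi / real m)"
    using assms(2) by (intro mult_right_mono) auto
  also have "\<dots> = pi - pi / real m" using m by (simp add: field_simps)
  finally show "b + real i * (pi / real m) < pi" using m by linarith
qed

lemma root_at_pos_root:
  assumes "root_angles e f b m" "i < m"
  shows "root_at e f b m i \<in> \<Delta>\<^sub>+"
proof -
  have "adapted e f" "arc e f (b + real i * (pi / real m)) \<in> \<Delta>"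
    using assms(1) by (auto simp: root_angles_def intro: exI[of _ "int i"])
  then show ?thesis
    using root_angles_bounds[OF assms] by (simp add: root_at_def pos_root_arc_iff sin_gt_zero)
qed

lemma root_at_add_period: "0 < m \<Longrightarrow> root_at e f b m (i + m) = - root_at e f b m i"
  using arc_pi(1)[of e f "b + real i * (pi / real m)"]
  by (simp add: root_at_def add.assoc add_divide_distrib distrib_right)

lemma pos_roots_in_plane:
  assumes "root_angles e f b m"
  shows "plane e f \<inter> \<Delta>\<^sub>+ = root_at e f b m ` {..<m}"
proof
  show "root_at e f b m ` {..<m} \<subseteq> plane e f \<inter> \<Delta>\<^sub>+"
    using root_at_pos_root[OF assms] by (auto simp: root_at_def arc_in_plane)
  show "plane e f \<inter> \<Delta>\<^sub>+ \<subseteq> root_at e f b m ` {..<m}"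
  proof
    fix \<gamma> assume \<gamma>: "\<gamma> \<in> plane e f \<inter> \<Delta>\<^sub>+"
    have ra: "adapted e f" "2 \<le> m" "0 < b" "b < pi / real m"
      using assms by (auto simp: root_angles_def)
    obtain x where x: "0 < x" "x < pi" "\<gamma> = arc e f x"
      using pos_root_in_plane_arc[OF ra(1)] \<gamma> by blast
    have "\<gamma> \<in> \<Delta>" using \<gamma> by (simp add: pos_root_iff)
    then obtain n :: int where n: "x = b + of_int n * (pi / real m)"
      using assms x(3) by (auto simp: root_angles_def)
    have d: "0 < pi / real m" using ra by simp
    have "(- 1) * (pi / real m) < of_int n * (pi / real m)" using n x(1) ra(4) by linarith
    then have "- 1 < real_of_int n" using d by (simp only: mult_less_cancel_right_pos)
    moreover have "of_int n * (pi / real m) < real m * (pi / real m)" using n x(2) ra by simp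
    then have "real_of_int n < real m" using d by (simp only: mult_less_cancel_right_pos)
    ultimately have "0 \<le> n" "nat n < m" by linarith+
    then show "\<gamma> \<in> root_at e f b m ` {..<m}"
      using n x(3) by (intro image_eqI[of _ _ "nat n"]) (auto simp: root_at_def)
  qed
qed

lemma roots_in_plane:
  assumes "root_angles e f b m"
  shows "{root_at e f b m i | i. i < m} \<union> {- root_at e f b m i | i. i < m} = plane e f \<inter> \<Delta>"
proof -
  have plane_uminus: "- \<gamma> \<in> plane e f" if "\<gamma> \<in> plane e f" for \<gamma>
  proof -
    obtain p q where "\<gamma> = scale p e + scale q f" using \<open>\<gamma> \<in> plane e f\<close> by (auto simp: plane_def)
    then have "- \<gamma> = scale (- p) e + scale (- q) f" by (simp add: scale_uminus_left)
    then show ?thesis using planeI by simp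
  qed
  have "\<gamma> \<in> {root_at e f b m i | i. i < m} \<union> {- root_at e f b m i | i. i < m}"
    if \<gamma>: "\<gamma> \<in> plane e f" "\<gamma> \<in> \<Delta>" for \<gamma>
    using pos_root_cases[OF \<gamma>(2)]
  proof
    assume "\<gamma> \<in> \<Delta>\<^sub>+"
    then show ?thesis using \<gamma> pos_roots_in_plane[OF assms] by auto
  next
    assume "- \<gamma> \<in> \<Delta>\<^sub>+"
    then have "- \<gamma> \<in> root_at e f b m ` {..<m}"
      using \<gamma> plane_uminus pos_roots_in_plane[OF assms] by auto
    then obtain i where "i < m" "- \<gamma> = root_at e f b m i" by auto
    then have "i < m" "\<gamma> = - root_at e f b m i" by (metis minus_minus)+
    then show ?thesis by blast
  qed
  moreover have "root_at e f b m i \<in> plane e f \<inter> \<Delta>" if "i < m" for i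
    using root_at_pos_root[OF assms that] by (simp add: root_at_def arc_in_plane pos_root_iff)
  ultimately show ?thesis using plane_uminus by auto
qed

lemma root_system_plane:
  assumes "orthonormal e f"
  shows "root_system (plane e f \<inter> \<Delta>)"
  unfolding root_system_def
proof (intro conjI ballI)
  show "finite (plane e f \<inter> \<Delta>)" using finite_roots by simp
  show "plane e f \<inter> \<Delta> \<subseteq> V - {0}"
    using root_V form_root[of 0] by fastforce
  fix \<gamma> assume \<gamma>: "\<gamma> \<in> plane e f \<inter> \<Delta>"
  obtain p q where pq: "\<gamma> = scale p e + scale q f" using \<gamma> by (auto simp: plane_def)
  have scale_plane: "scale r \<gamma> \<in> plane e f" for r
    unfolding pq scale_add scale_scale by (rule planeI)
  show "plane e f \<inter> \<Delta> \<inter> range (\<lambda>r. scale r \<gamma>) = {\<gamma>, - \<gamma>}"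
  proof
    show "plane e f \<inter> \<Delta> \<inter> range (\<lambda>r. scale r \<gamma>) \<subseteq> {\<gamma>, - \<gamma>}"
    proof
      fix \<delta> assume "\<delta> \<in> plane e f \<inter> \<Delta> \<inter> range (\<lambda>r. scale r \<gamma>)"
      then obtain r where r: "\<delta> = scale r \<gamma>" "scale r \<gamma> \<in> \<Delta>" by auto
      then have "r * r = 1" using \<gamma> form_root[of "scale r \<gamma>"] by simp
      then have "r = 1 \<or> r = - 1" using power2_eq_1_iff[of r] by (simp add: power2_eq_square)
      then show "\<delta> \<in> {\<gamma>, - \<gamma>}" using r(1) by (auto simp: scale_minus_1)
    qed
    show "{\<gamma>, - \<gamma>} \<subseteq> plane e f \<inter> \<Delta> \<inter> range (\<lambda>r. scale r \<gamma>)"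
      using \<gamma> scale_plane[of "- 1"] rangeI[of "\<lambda>r. scale r \<gamma>" 1] rangeI[of "\<lambda>r. scale r \<gamma>" "- 1"]
      by (simp add: scale_minus_1)
  qed
  have unit: "form \<gamma> \<gamma> = 1" using \<gamma> by simp
  have mem: "unit_reflection \<gamma> \<delta> \<in> plane e f \<inter> \<Delta>" if "\<delta> \<in> plane e f \<inter> \<Delta>" for \<delta>
  proof -
    have "unit_reflection \<gamma> \<delta> = scale 1 \<delta> + scale (- 2 * form \<delta> \<gamma>) \<gamma>"
      by (simp add: unit_reflection_def scale_uminus_left)
    then have "unit_reflection \<gamma> \<delta> \<in> plane e f"
      using plane_subset[of \<delta> e f \<gamma>] planeI[of 1 \<delta>] that \<gamma> by auto
    then show ?thesis using root_unit_reflection \<gamma> that by blast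
  qed
  show "reflection \<gamma> ` (plane e f \<inter> \<Delta>) = plane e f \<inter> \<Delta>"
    unfolding reflection_eq_unit_reflection[OF unit]
  proof
    show "unit_reflection \<gamma> ` (plane e f \<inter> \<Delta>) \<subseteq> plane e f \<inter> \<Delta>" using mem by blast
    show "plane e f \<inter> \<Delta> \<subseteq> unit_reflection \<gamma> ` (plane e f \<inter> \<Delta>)"
    proof
      fix \<delta> assume "\<delta> \<in> plane e f \<inter> \<Delta>"
      then show "\<delta> \<in> unit_reflection \<gamma> ` (plane e f \<inter> \<Delta>)"
        using mem by (intro image_eqI[of _ _ "unit_reflection \<gamma> \<delta>"]) (simp_all only: unit_reflection_involution[OF unit])
    qed
  qed
qed

text \<open>Pairing with the arc a quarter turn past y annihilates the line at angle y, so in a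
  linear relation between arcs it removes one term.\<close>

lemma form_arc_quarter:
  "orthonormal e f \<Longrightarrow> form (arc e f x) (arc e f (y + pi / 2)) = sin (x - y)"
  using cos_diff[of "x - y" "pi / 2"] by (simp add: form_arc diff_diff_eq)

text \<open>The outermost positive roots, of index 0 and m - 1, serve as the simple system: all
  positive roots of the plane lie between them. Neighbours enclose only the angle d, so their cone
  contains no further root.\<close>

lemma dihedral_seq_root_at:
  assumes "root_angles e f b m"
  shows "dihedral_seq m (root_at e f b m)"
proof -
  let ?g = "root_at e f b m"
  define d where "d = pi / real m"
  have g: "?g i = arc e f (b + real i * d)" for i by (simp add: root_at_def d_def)
  have ad: "adapted e f" and m: "2 \<le> m" using assms by (auto simp: root_angles_def)
  have on: "orthonormal e f" using ad by (rule adapted_orthonormal)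
  have d: "0 < d" "d < pi" "real m * d = pi" using m by (auto simp: d_def field_simps)
  have sin_pos: "0 < sin (r * d)" if "0 < r" "r < real m" for r
  proof (rule sin_gt_zero)
    show "0 < r * d" using that d by simp
    have "r * d < real m * d" using that d by (intro mult_strict_right_mono) auto
    then show "r * d < pi" using d by simp
  qed
  have sin_nonneg: "0 \<le> sin (r * d)" if "0 \<le> r" "r < real m" for r
    using sin_pos[of r] that by (cases "r = 0") auto
  define l where "l = real m - 1"
  have l: "?g (m - 1) = arc e f (b + l * d)" using m by (simp add: g l_def of_nat_diff)
  have sl: "0 < sin (l * d)" using m by (intro sin_pos) (auto simp: l_def)
  have last: "(b + l * d) - b = l * d" by simp
  have simple: "\<exists>x y. 0 \<le> x \<and> 0 \<le> y \<and> (\<gamma> = scale x (?g 0) + scale y (?g (m - 1)) \<or>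
      \<gamma> = - (scale x (?g 0) + scale y (?g (m - 1))))" if "\<gamma> \<in> plane e f \<inter> \<Delta>" for \<gamma>
  proof -
    have "\<gamma> \<in> {?g i | i. i < m} \<union> {- ?g i | i. i < m}"
      using that unfolding roots_in_plane[OF assms] .
    then obtain i where i: "i < m" "\<gamma> = ?g i \<or> \<gamma> = - ?g i"
      by blast
    define x where "x = sin ((l - real i) * d) / sin (l * d)"
    define y where "y = sin (real i * d) / sin (l * d)"
    have "0 \<le> l - real i" "l - real i < real m" using i(1) by (simp_all add: l_def)
    then have "0 \<le> x" "0 \<le> y"
      using sl i(1) sin_nonneg[of "l - real i"] sin_nonneg[of "real i"]
      by (simp_all add: x_def y_def)
    moreover have gi: "?g i = scale x (?g 0) + scale y (?g (m - 1))"
    proof -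
      have eqs: "b + l * d - (b + real i * d) = (l - real i) * d" "b + l * d - b = l * d"
        "b + real i * d - b = real i * d"
        by (simp_all add: left_diff_distrib)
      have g0: "?g 0 = arc e f b" by (simp add: g)
      have "sin (b + l * d - b) \<noteq> 0" using sl by simp
      from arc_combination[OF this, of e f "b + real i * d"]
      show ?thesis unfolding l g[of i] g0 x_def y_def eqs .
    qed
    moreover have "\<gamma> = scale x (?g 0) + scale y (?g (m - 1)) \<or> \<gamma> = - (scale x (?g 0) + scale y (?g (m - 1)))"
      using i(2) unfolding gi .
    ultimately show ?thesis by blast
  qed
  have unit: "form (?g i) (?g i) = 1" for i by (simp add: g form_arc[OF on])
  have indep: "?g (m - 1) \<notin> range (\<lambda>r. scale r (?g 0))"
  proof
    assume "?g (m - 1) \<in> range (\<lambda>r. scale r (?g 0))"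
    then obtain r where r: "?g (m - 1) = scale r (?g 0)" by blast
    have "form (?g (m - 1)) (arc e f (b + pi / 2)) = r * form (?g 0) (arc e f (b + pi / 2))"
      unfolding r by (rule form_scale_left)
    then show False using sl unfolding l unfolding g form_arc_quarter[OF on] by simp
  qed
  have order: "((reflection (?g 0) \<circ> reflection (?g (m - 1))) ^^ m) v = v" for v
  proof -
    have "real m * (b - (b + l * d)) = - l * (real m * d)" by simp
    also have "\<dots> = pi * of_int (1 - int m)" by (simp add: d l_def)
    finally have "((unit_reflection (arc e f b) \<circ> unit_reflection (arc e f (b + l * d))) ^^ m) v = v"
      by (rule funpow_unit_reflection_eq_id[OF on])
    then show ?thesis
      unfolding reflection_eq_unit_reflection[OF unit] unfolding l by (simp add: g)
  qed
  have not_id: "\<not> (\<forall>v\<in>V. ((reflection (?g 0) \<circ> reflection (?g (m - 1))) ^^ j) v = v)"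
    if j: "0 < j" "j < m" for j
  proof
    assume "\<forall>v\<in>V. ((reflection (?g 0) \<circ> reflection (?g (m - 1))) ^^ j) v = v"
    moreover have "arc e f 0 \<in> V" using ad by (simp add: arc_def adapted_def)
    ultimately have "arc e f 0 = ((reflection (?g 0) \<circ> reflection (?g (m - 1))) ^^ j) (arc e f 0)"
      by metis
    also have "\<dots> = arc e f (0 + 2 * real j * (b - (b + l * d)))"
      unfolding reflection_eq_unit_reflection[OF unit] unfolding l
      using funpow_unit_reflection_arc[OF on, of 0 j b "b + l * d" 1 0] by (simp add: g)
    \<comment> \<open>Since m d = pi, the rotation angle -2 j (m - 1) d equals 2 j d up to full
      turns, and for 0 < j < m this is not a full turn.\<close>
    also have "0 + 2 * real j * (b - (b + l * d)) = 2 * (real j * d) + 2 * pi * of_int (- int j)"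
      unfolding l_def d(3)[symmetric] by (simp add: algebra_simps)
    finally have "arc e f 0 = arc e f (2 * (real j * d))" by (simp only: arc_2pi)
    then have "cos (2 * (real j * d)) = 1"
      using form_arc[OF on, of "2 * (real j * d)" 0] form_arc[OF on, of 0 0] by simp
    then have "sin (real j * d) = 0" by (simp add: cos_double_sin)
    then show False using sin_pos[of "real j"] j by simp
  qed
  have I2: "root_system_I2 m ({?g i | i. i < m} \<union> {- ?g i | i. i < m})"
    unfolding root_system_I2_def roots_in_plane[OF assms]
  proof (intro conjI, rule root_system_plane[OF on], rule bexI[of _ "?g 0"],
      rule bexI[of _ "?g (m - 1)"], intro conjI)
    show "?g (m - 1) \<notin> range (\<lambda>r. scale r (?g 0))" by (rule indep)
    show "\<forall>\<gamma>\<in>plane e f \<inter> \<Delta>. \<exists>x y. 0 \<le> x \<and> 0 \<le> y \<and>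
        (\<gamma> = scale x (?g 0) + scale y (?g (m - 1)) \<or> \<gamma> = - (scale x (?g 0) + scale y (?g (m - 1))))"
      using simple by blast
    show "0 < m" using m by simp
    show "\<forall>v\<in>V. ((reflection (?g 0) \<circ> reflection (?g (m - 1))) ^^ m) v = v" using order by blast
    show "\<forall>j. 0 < j \<and> j < m \<longrightarrow> \<not> (\<forall>v\<in>V. ((reflection (?g 0) \<circ> reflection (?g (m - 1))) ^^ j) v = v)"
      using not_id by blast
    show "?g 0 \<in> plane e f \<inter> \<Delta>" "?g (m - 1) \<in> plane e f \<inter> \<Delta>"
      using m unfolding roots_in_plane[OF assms, symmetric] by auto
  qed
  have cone: "{scale x (?g i) + scale y (?g (i + 1)) | x y. 0 \<le> x \<and> 0 \<le> y} \<inter> \<Delta>\<^sub>+ = {?g i, ?g (i + 1)}"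
    if i: "i + 2 \<le> m" for i
  proof
    have "?g i = scale 1 (?g i) + scale 0 (?g (i + 1))" "?g (i + 1) = scale 0 (?g i) + scale 1 (?g (i + 1))"
      by simp_all
    then have "?g i \<in> {scale x (?g i) + scale y (?g (i + 1)) | x y. 0 \<le> x \<and> 0 \<le> y}"
      "?g (i + 1) \<in> {scale x (?g i) + scale y (?g (i + 1)) | x y. 0 \<le> x \<and> 0 \<le> y}"
      using zero_le_one order_refl by blast+
    then show "{?g i, ?g (i + 1)} \<subseteq> {scale x (?g i) + scale y (?g (i + 1)) | x y. 0 \<le> x \<and> 0 \<le> y} \<inter> \<Delta>\<^sub>+"
      using root_at_pos_root[OF assms] i by auto
    show "{scale x (?g i) + scale y (?g (i + 1)) | x y. 0 \<le> x \<and> 0 \<le> y} \<inter> \<Delta>\<^sub>+ \<subseteq> {?g i, ?g (i + 1)}"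
    proof clarify
      fix x y :: real
      assume xy: "0 \<le> x" "0 \<le> y" and pos: "scale x (?g i) + scale y (?g (i + 1)) \<in> \<Delta>\<^sub>+"
        and not: "scale x (?g i) + scale y (?g (i + 1)) \<noteq> ?g i"
      have "scale x (?g i) + scale y (?g (i + 1)) \<in> plane e f"
        using plane_subset[of "?g i" e f "?g (i + 1)"] planeI by (auto simp: g arc_in_plane)
      then obtain n where n: "n < m" "scale x (?g i) + scale y (?g (i + 1)) = ?g n"
        using pos pos_roots_in_plane[OF assms] by blast
      \<comment> \<open>Taking z as the angle of \<open>?g i\<close> or of \<open>?g (i + 1)\<close>
        removes one summand; the sign of the other then excludes n < i or n > i + 1,
        respectively.\<close>
      have eq: "x * sin ((b + real i * d) - z) + y * sin ((b + real (i + 1) * d) - z)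
          = sin ((b + real n * d) - z)" for z
      proof -
        have "form (scale x (?g i) + scale y (?g (i + 1))) (arc e f (z + pi / 2))
            = form (?g n) (arc e f (z + pi / 2))"
          by (simp only: n(2))
        then show ?thesis
          by (simp only: g form_add_left form_scale_left form_arc_quarter[OF on])
      qed
      have sd: "0 < sin d" using sin_pos[of 1] m by simp
      have "\<not> n < i"
      proof
        assume "n < i"
        have "y * sin d = - sin ((real i - real n) * d)"
          using eq[of "b + real i * d"] sin_minus[of "(real i - real n) * d"]
          by (simp add: algebra_simps)
        moreover have "0 < sin ((real i - real n) * d)"
          using \<open>n < i\<close> i by (intro sin_pos) auto
        moreover have "0 \<le> y * sin d" using xy sd by simp
        ultimately show False by linarith
      qed
      moreover have "\<not> i + 1 < n"
      proof
        assume "i + 1 < n"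
        have "- (x * sin d) = sin ((real n - real (i + 1)) * d)"
          using eq[of "b + real (i + 1) * d"] sin_minus[of d]
          by (simp add: algebra_simps)
        moreover have "0 < sin ((real n - real (i + 1)) * d)"
          using \<open>i + 1 < n\<close> n(1) by (intro sin_pos) auto
        moreover have "0 \<le> x * sin d" using xy sd by simp
        ultimately show False by linarith
      qed
      ultimately have "n = i \<or> n = i + 1" by linarith
      then show "scale x (?g i) + scale y (?g (i + 1)) = ?g (i + 1)" using n(2) not by metis
    qed
  qed
  show ?thesis
    unfolding dihedral_seq_def
    using m root_at_pos_root[OF assms] root_at_add_period[of m e f b] I2 cone by auto
qed

text \<open>Replacing e by - e turns the angle x into pi - x and keeps the basis adapted. The new
  first angle is pi minus the old last one: pi - (b + (m - 1) pi/m) = pi/m - b.\<close>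

lemma root_angles_reverse:
  assumes "root_angles e f b m"
  shows "root_angles (- e) f (pi / real m - b) m"
proof -
  have "adapted e f" using assms by (simp add: root_angles_def)
  then have "adapted (- e) f"
    by (auto simp: adapted_def orthonormal_def V_def height_uminus)
  moreover have "arc (- e) f x = arc e f (pi - x)" for x
    by (simp add: arc_def scale_uminus scale_uminus_left)
  moreover have "(\<exists>n::int. pi - x = b + of_int n * (pi / real m))
      \<longleftrightarrow> (\<exists>n::int. x = pi / real m - b + of_int n * (pi / real m))" for x
  proof -
    define d where "d = pi / real m"
    have d: "real m * d = pi" using assms by (simp add: root_angles_def d_def)
    have eq: "pi - x = b + of_int n * d \<longleftrightarrow> x = d - b + of_int (int m - 1 - n) * d" for n :: int
      using d by (auto simp: algebra_simps)
    have "int m - 1 - (int m - 1 - n) = n" for n :: int by simp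
    then show ?thesis unfolding d_def[symmetric] using eq by metis
  qed
  ultimately show ?thesis
    using assms by (simp add: root_angles_def)
qed

lemma root_at_reverse_eq:
  assumes "0 < m"
  shows "root_at (- e) f (pi / real m - b) m i = arc e f (b + (real m - 1 - real i) * (pi / real m))"
proof -
  define d where "d = pi / real m"
  have "real m * d = pi" using assms by (simp add: d_def)
  then have "pi - (pi / real m - b + real i * (pi / real m)) = b + (real m - 1 - real i) * (pi / real m)"
    unfolding d_def[symmetric] by (simp add: algebra_simps)
  moreover have "arc (- e) f x = arc e f (pi - x)" for x
    by (simp add: arc_def scale_uminus scale_uminus_left)
  ultimately show ?thesis by (simp only: root_at_def)
qed

lemma root_at_reverse:
  assumes "i + j + 1 = m"
  shows "root_at (- e) f (pi / real m - b) m i = root_at e f b m j"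
proof -
  have "real m - 1 - real i = real j" using assms by linarith
  moreover have "0 < m" using assms by simp
  ultimately show ?thesis using root_at_reverse_eq[of m e f b i] by (simp only: root_at_def)
qed

lemma root_at_reverse_period:
  assumes "i + j + 1 = 2 * m"
  shows "root_at (- e) f (pi / real m - b) m i = - root_at e f b m j"
proof -
  have m: "0 < m" using assms by simp
  have "real m - 1 - real i = real j - real m" using assms by linarith
  moreover have "b + (real j - real m) * (pi / real m) = b + real j * (pi / real m) - pi"
    using m by (simp only: left_diff_distrib) simp
  ultimately show ?thesis
    using root_at_reverse_eq[OF m, of e f b i] arc_pi(2)[of e f "b + real j * (pi / real m)"]
    by (simp only: root_at_def)
qed

end

section \<open>Coefficients and monomials of the free algebra\<close>

lemma free_algebra_simps [simp]:
  "mult (free_algebra S G) = (*)" "add (free_algebra S G) = (+)"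
  "one (free_algebra S G) = 1" "ring.zero (free_algebra S G) = 0"
  by (simp_all add: free_algebra_def)

lemma poly_const_0 [simp]: "poly_const 0 = 0"
  and poly_const_1 [simp]: "poly_const 1 = 1"
  and poly_const_add: "poly_const (a + b) = poly_const a + poly_const b"
  and poly_const_diff: "poly_const (a - b) = poly_const a - poly_const b"
  and poly_const_uminus: "poly_const (- a) = - poly_const a"
  and poly_const_mult: "poly_const (a * b) = poly_const a * poly_const b"
  by (simp_all add: poly_const_def single_add single_diff single_uminus mult_single)

lemma poly_const_polys [simp]: "poly_const r \<in> polys S"
  by (auto simp: poly_const_def polys_def)

lemma single_in_free_algebra:
  assumes "w \<in> lists G" "p \<in> polys S"
  shows "Poly_Mapping.single w p \<in> carrier (free_algebra S G)"
  using assms by (auto simp: free_algebra_def lookup_single when_def polys_0)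

section \<open>Congruences in the bracket algebra\<close>

context finite_coxeter_system
begin

abbreviation A where "A \<equiv> carrier free_bracket"

lemma A_add: "x \<in> A \<Longrightarrow> y \<in> A \<Longrightarrow> x + y \<in> A"
  using ring.ring_simprules(1)[OF ring_free_algebra[of S \<Delta>]] by simp

lemma A_mult: "x \<in> A \<Longrightarrow> y \<in> A \<Longrightarrow> x * y \<in> A"
  using ring.ring_simprules(5)[OF ring_free_algebra[of S \<Delta>]] by simp

lemma A_0 [simp]: "0 \<in> A" and A_1 [simp]: "1 \<in> A"
  using ring.ring_simprules(2,6)[OF ring_free_algebra[of S \<Delta>]] by simp_all

lemma A_uminus: "x \<in> A \<Longrightarrow> - x \<in> A"
  by (simp add: free_algebra_def polys_uminus)

lemma A_diff: "x \<in> A \<Longrightarrow> y \<in> A \<Longrightarrow> x - y \<in> A"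
  using A_add[of x "- y"] A_uminus by simp

lemma A_sum: "(\<And>i. i \<in> J \<Longrightarrow> f i \<in> A) \<Longrightarrow> sum f J \<in> A"
  by (induction J rule: infinite_finite_induct) (auto intro: A_add)

lemma A_prod_list: "(\<And>x. x \<in> set xs \<Longrightarrow> x \<in> A) \<Longrightarrow> prod_list xs \<in> A"
  by (induction xs) (auto intro: A_mult)

lemma A_fgen [simp]: "\<gamma> \<in> \<Delta> \<Longrightarrow> fgen \<gamma> \<in> A"
  unfolding fgen_def by (rule single_in_free_algebra) (auto simp: polys_1)

lemma A_fscalar: "p \<in> polys S \<Longrightarrow> fscalar p \<in> A"
  unfolding fscalar_def by (rule single_in_free_algebra) auto

lemma dihedral_seq_root:
  assumes "dihedral_seq m \<gamma>" "i < 2 * m"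
  shows "\<gamma> i \<in> \<Delta>"
proof (cases "i < m")
  case True
  then show ?thesis using assms by (auto simp: dihedral_seq_def pos_roots_def)
next
  case False
  then have "\<gamma> i = - \<gamma> (i - m)" "\<gamma> (i - m) \<in> \<Delta>"
    using assms by (auto simp: dihedral_seq_def pos_roots_def dest!: spec[of _ "i - m"])
  then show ?thesis by (simp only: root_uminus)
qed

lemma relations_in_free_algebra: "rel_neg \<union> rel_square \<union> rel_quadratic \<union> rel_fourterm \<subseteq> A"
proof (intro Un_least subsetI)
  fix x
  show "x \<in> A" if "x \<in> rel_neg"
    using that by (auto simp: rel_neg_def intro!: A_add A_fgen)
  have simple: "\<alpha> s \<in> \<Delta>" if "s \<in> S" for s
    using rootI[OF one_closed that] by simp
  have var: "poly_var s \<in> polys S" if "s \<in> S" for s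
    using that by (auto simp: poly_var_def polys_def)
  show "x \<in> A" if "x \<in> rel_square"
    using that by (auto simp: rel_square_def pos_roots_def
        intro!: A_diff A_mult A_fgen A_fscalar simple var)
  show "x \<in> A" if "x \<in> rel_quadratic"
    using that by (auto simp: rel_quadratic_def intro!: A_sum A_mult A_fgen dihedral_seq_root)
  show "x \<in> A" if rel: "x \<in> rel_fourterm"
  proof -
    obtain m \<gamma> k up down where x:
      "x = fgen (\<gamma> k) * up + up * fgen (\<gamma> k) + fgen (\<gamma> k) * down + down * fgen (\<gamma> k)"
      "dihedral_seq m \<gamma>" "4 \<le> m" "k = m div 2 - 1"
      "up = prod_list (map (\<lambda>i. fgen (\<gamma> i)) [0..<2 * k + 1])"
      "down = prod_list (map (\<lambda>i. fgen (\<gamma> i)) (rev [0..<2 * k + 1]))"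
      using rel unfolding rel_fourterm_def by blast
    have "fgen (\<gamma> i) \<in> A" if "i < 2 * k + 1" for i
      using that x(3,4) by (intro A_fgen dihedral_seq_root[OF x(2)]) linarith
    moreover from this have "up \<in> A" "down \<in> A"
      unfolding x(5,6) by (intro A_prod_list; auto simp del: upt_Suc)+
    moreover have "k < 2 * k + 1" by simp
    ultimately have "up \<in> A" "down \<in> A" "fgen (\<gamma> k) \<in> A" by blast+
    then show ?thesis unfolding x(1) by (intro A_add A_mult)
  qed
qed

lemma ideal_qBE: "ideal qBE_ideal free_bracket"
  unfolding qBE_ideal_def
  using ring.genideal_ideal[OF ring_free_algebra relations_in_free_algebra] .

lemma relation_in_ideal:
  "x \<in> rel_neg \<union> rel_square \<union> rel_quadratic \<union> rel_fourterm \<Longrightarrow> x \<in> qBE_ideal"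
  unfolding qBE_ideal_def
  using ring.genideal_self[OF ring_free_algebra relations_in_free_algebra] by blast

abbreviation I where "I \<equiv> qBE_ideal"

lemma I_add: "x \<in> I \<Longrightarrow> y \<in> I \<Longrightarrow> x + y \<in> I"
  using additive_subgroup.a_closed[OF ideal.axioms(1)[OF ideal_qBE]] by simp

lemma I_0 [simp]: "0 \<in> I"
  using additive_subgroup.zero_closed[OF ideal.axioms(1)[OF ideal_qBE]] by simp

lemma I_mult_left: "x \<in> I \<Longrightarrow> y \<in> A \<Longrightarrow> y * x \<in> I"
  using ideal.I_l_closed[OF ideal_qBE] by simp

lemma I_uminus: "x \<in> I \<Longrightarrow> - x \<in> I"
  using I_mult_left[of x "- 1"] A_uminus[OF A_1] by simp

lemma I_diff: "x \<in> I \<Longrightarrow> y \<in> I \<Longrightarrow> x - y \<in> I"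
  using I_add[of x "- y"] I_uminus by simp

lemma I_sum: "(\<And>i. i \<in> J \<Longrightarrow> f i \<in> I) \<Longrightarrow> sum f J \<in> I"
  by (induction J rule: infinite_finite_induct) (auto intro: I_add)

definition quad_term :: "real \<Rightarrow> 'a vec \<Rightarrow> 'a vec \<Rightarrow> ('a, 'a vec) free_alg" where
  "quad_term a \<gamma> \<delta> = Poly_Mapping.single [\<gamma>, \<delta>] (poly_const a)"

lemma quad_term_0 [simp]: "quad_term 0 \<gamma> \<delta> = 0"
  and quad_term_diff: "quad_term (a - b) \<gamma> \<delta> = quad_term a \<gamma> \<delta> - quad_term b \<gamma> \<delta>"
  and quad_term_uminus: "quad_term (- a) \<gamma> \<delta> = - quad_term a \<gamma> \<delta>"
  by (simp_all add: quad_term_def poly_const_diff poly_const_uminus single_diff single_uminus)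

lemma quad_term_eq: "quad_term a \<gamma> \<delta> = fscalar (poly_const a) * (fgen \<gamma> * fgen \<delta>)"
  by (simp add: quad_term_def fscalar_def fgen_def mult_single plus_list_def)

lemma quad_term_neg:
  assumes "\<gamma> \<in> \<Delta>" "\<delta> \<in> \<Delta>"
  shows "quad_term a \<gamma> (- \<delta>) + quad_term a \<gamma> \<delta> \<in> I"
proof -
  have "fgen (- \<delta>) + fgen \<delta> \<in> I"
    using assms(2) by (intro relation_in_ideal) (auto simp: rel_neg_def)
  then have "fscalar (poly_const a) * (fgen \<gamma> * (fgen (- \<delta>) + fgen \<delta>)) \<in> I"
    using assms(1) by (intro I_mult_left A_fscalar A_fgen poly_const_polys)
  then show ?thesis by (simp add: quad_term_eq distrib_left)
qed

lemma quadratic_dihedral: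
  assumes "dihedral_seq m \<gamma>" "1 \<le> k" "2 * k \<le> m"
  shows "(\<Sum>i<m. quad_term a (\<gamma> i) (\<gamma> (i + k))) \<in> I"
proof -
  have "(\<Sum>i<m. fgen (\<gamma> i) * fgen (\<gamma> (i + k))) \<in> I"
    using assms by (intro relation_in_ideal) (auto simp: rel_quadratic_def)
  then have "fscalar (poly_const a) * (\<Sum>i<m. fgen (\<gamma> i) * fgen (\<gamma> (i + k))) \<in> I"
    by (intro I_mult_left A_fscalar poly_const_polys)
  then show ?thesis by (simp add: quad_term_eq sum_distrib_left)
qed

lemma root_at_root: "root_angles e f b m \<Longrightarrow> root_at e f b m i \<in> \<Delta>"
  by (auto simp: root_angles_def root_at_def intro: exI[of _ "int i"])

text \<open>The relations for \<open>k > m/2\<close> are those for \<open>m - k\<close> in the reversed sequence.\<close>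

lemma quadratic_root_at:
  assumes "root_angles e f b m" "1 \<le> k" "k < m"
  shows "(\<Sum>i<m. quad_term a (root_at e f b m i) (root_at e f b m (i + k))) \<in> I"
proof (cases "2 * k \<le> m")
  case True
  then show ?thesis
    using quadratic_dihedral[OF dihedral_seq_root_at[OF assms(1)]] assms(2) by blast
next
  case False
  let ?g = "root_at e f b m"
  let ?h = "root_at (- e) f (pi / real m - b) m"
  have "(\<Sum>i<m. quad_term a (?h i) (?h (i + (m - k)))) \<in> I"
    using quadratic_dihedral[OF dihedral_seq_root_at[OF root_angles_reverse[OF assms(1)]], of "m - k" a]
      assms(3) False by simp
  \<comment> \<open>From the reversed position of j, a step by m - k leads to the angle of index j +
    k - m, whose root is minus that of index j + k.\<close>
  also have "(\<Sum>i<m. quad_term a (?h i) (?h (i + (m - k))))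
      = (\<Sum>i<m. quad_term a (?g (m - Suc i)) (- ?g (m - Suc i + k)))"
  proof (rule sum.cong[OF HOL.refl])
    fix i assume "i \<in> {..<m}"
    then have "?h i = ?g (m - Suc i)" "?h (i + (m - k)) = - ?g (m - Suc i + k)"
      using assms(3) by (intro root_at_reverse root_at_reverse_period; simp)+
    then show "quad_term a (?h i) (?h (i + (m - k))) = quad_term a (?g (m - Suc i)) (- ?g (m - Suc i + k))"
      by (simp only:)
  qed
  also have "\<dots> = (\<Sum>i<m. quad_term a (?g i) (- ?g (i + k)))"
    by (rule sum.nat_diff_reindex)
  finally have 1: "(\<Sum>i<m. quad_term a (?g i) (- ?g (i + k))) \<in> I" .
  have "(\<Sum>i<m. quad_term a (?g i) (- ?g (i + k)) + quad_term a (?g i) (?g (i + k))) \<in> I"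
    by (intro I_sum quad_term_neg root_at_root[OF assms(1)])
  from I_diff[OF this 1] show ?thesis by (simp add: sum.distrib)
qed

text \<open>Moving the window by one place replaces \<open>F i\<close> by \<open>F (i + m)\<close>,
  a congruent term.\<close>

lemma sum_window:
  fixes F :: "nat \<Rightarrow> ('a, 'a vec) free_alg"
  assumes "\<And>j. F (j + m) - F j \<in> I"
  shows "(\<Sum>k<m. F (i + k)) - (\<Sum>k<m. F k) \<in> I"
proof (induction i)
  case (Suc i)
  have "(\<Sum>k<m. F (Suc i + k)) + F i = (\<Sum>k<Suc m. F (i + k))"
    by (subst sum.lessThan_Suc_shift) simp
  then have "(\<Sum>k<m. F (Suc i + k)) - (\<Sum>k<m. F k)
      = ((\<Sum>k<m. F (i + k)) - (\<Sum>k<m. F k)) + (F (i + m) - F i)"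
    by (simp add: algebra_simps)
  then show ?case using I_add[OF Suc assms] by metis
qed simp

text \<open>Each row covers a full period in j modulo \<open>I\<close>, so it may as well start at j
  = i; interchanging the sums then gives, for every k, one quadratic relation times K sin(k
  pi/m).\<close>

lemma plane_sum:
  assumes "root_angles e f b m"
  defines "g \<equiv> root_at e f b m"
  shows "(\<Sum>i<m. \<Sum>j<m. quad_term (K * sin ((real j - real i) * (pi / real m))) (g i) (g j)) \<in> I"
proof -
  define d where "d = pi / real m"
  have m: "0 < m" using assms(1) by (simp add: root_angles_def)
  have root: "g i \<in> \<Delta>" for i using root_at_root[OF assms(1)] by (simp add: g_def)
  define F where "F = (\<lambda>i j. quad_term (K * sin ((real j - real i) * d)) (g i) (g j))"
  have periodic: "F i (j + m) - F i j \<in> I" for i j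
  proof -
    have "(real (j + m) - real i) * d = (real j - real i) * d + pi"
      using m by (simp add: d_def field_simps)
    moreover have "g (j + m) = - g j" unfolding g_def by (rule root_at_add_period[OF m])
    ultimately have "F i (j + m) - F i j
        = - (quad_term (K * sin ((real j - real i) * d)) (g i) (- g j) + quad_term (K * sin ((real j - real i) * d)) (g i) (g j))"
      by (simp add: F_def quad_term_uminus)
    then show ?thesis using I_uminus[OF quad_term_neg[OF root root]] by metis
  qed
  have "(\<Sum>i<m. (\<Sum>k<m. F i (i + k)) - (\<Sum>k<m. F i k)) \<in> I"
    by (intro I_sum sum_window periodic)
  moreover have "(\<Sum>i<m. \<Sum>k<m. F i (i + k)) \<in> I"
  proof -
    have "(\<Sum>i<m. F i (i + k)) \<in> I" if "k < m" for k
    \<comment> \<open>For k = 0 the terms are squares with coefficient sin 0 = 0.\<close>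
    proof (cases "k = 0")
      case False
      then show ?thesis
        using quadratic_root_at[OF assms(1), of k "K * sin (real k * d)"] that
        by (simp add: F_def g_def)
    qed (simp add: F_def)
    then show ?thesis by (subst sum.swap) (auto intro: I_sum)
  qed
  ultimately have "(\<Sum>i<m. \<Sum>k<m. F i (i + k)) - (\<Sum>i<m. (\<Sum>k<m. F i (i + k)) - (\<Sum>k<m. F i k)) \<in> I"
    by (intro I_diff)
  then show ?thesis by (simp add: sum_subtractf F_def d_def)
qed

section \<open>Commuting elements\<close>

definition linear_functional :: "('a vec \<Rightarrow> real) \<Rightarrow> bool" where
  "linear_functional L \<longleftrightarrow> (\<forall>u v. L (u + v) = L u + L v) \<and> (\<forall>r u. L (scale r u) = r * L u)"

definition dunkl_sum :: "('a vec \<Rightarrow> real) \<Rightarrow> ('a, 'a vec) free_alg" where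
  "dunkl_sum L = (\<Sum>\<gamma>\<in>\<Delta>\<^sub>+. Poly_Mapping.single [\<gamma>] (poly_const (L \<gamma>)))"

lemma finite_pos_roots [simp]: "finite \<Delta>\<^sub>+"
  using finite_roots by (simp add: pos_roots_def)

lemma A_dunkl_sum: "dunkl_sum L \<in> A"
  unfolding dunkl_sum_def
  by (intro A_sum single_in_free_algebra) (auto simp: pos_roots_def)

lemma dunkl_sum_mult:
  "dunkl_sum L * dunkl_sum M = (\<Sum>\<gamma>\<in>\<Delta>\<^sub>+. \<Sum>\<delta>\<in>\<Delta>\<^sub>+. quad_term (L \<gamma> * M \<delta>) \<gamma> \<delta>)"
  by (simp add: dunkl_sum_def sum_product mult_single plus_list_def quad_term_def poly_const_mult)

text \<open>An alternating form on a plane is a multiple of the area form, here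
  \<open>sin (y - x)\<close>; the factor is its value at the pair e, f.\<close>

lemma linear_functional_wedge_arc:
  assumes "linear_functional L" "linear_functional M"
  shows "L (arc e f x) * M (arc e f y) - M (arc e f x) * L (arc e f y)
    = (L e * M f - M e * L f) * sin (y - x)"
proof -
  have "L (arc e f x) = cos x * L e + sin x * L f" "M (arc e f x) = cos x * M e + sin x * M f" for x
    using assms by (simp_all add: linear_functional_def arc_def)
  then show ?thesis by (simp add: sin_diff algebra_simps)
qed

text \<open>Distinct positive roots are not proportional, so a pair of them spans any plane that
  contains both; this is why grouping by planes partitions the pairs.\<close>

lemma plane_pos_roots:
  assumes "adapted e f" "\<gamma> \<in> plane e f" "\<delta> \<in> plane e f" "\<gamma> \<in> \<Delta>\<^sub>+" "\<delta> \<in> \<Delta>\<^sub>+" "\<gamma> \<noteq> \<delta>"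
  shows "plane \<gamma> \<delta> = plane e f"
proof -
  obtain x where x: "\<gamma> = arc e f x" using pos_root_in_plane_arc[OF assms(1,2,4)] by blast
  obtain y where y: "\<delta> = arc e f y" using pos_root_in_plane_arc[OF assms(1,3,5)] by blast
  have "sin (y - x) \<noteq> 0"
  proof
    assume "sin (y - x) = 0"
    then have "\<delta> = - \<gamma>" using arc_sin_eq_0 assms(6) x y by metis
    then show False using height_pos_root[OF assms(4)] height_pos_root[OF assms(5)] by (simp add: height_uminus)
  qed
  then show ?thesis unfolding x y by (rule plane_arc)
qed

lemma root_at_inj:
  assumes "root_angles e f b m"
  shows "inj_on (root_at e f b m) {..<m}"
proof (rule linorder_inj_onI)
  fix i j assume ij: "i < j" "i \<in> {..<m}" "j \<in> {..<m}"
  have on: "orthonormal e f" using assms by (simp add: root_angles_def adapted_def)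
  show "root_at e f b m i \<noteq> root_at e f b m j"
  proof
    assume eq: "root_at e f b m i = root_at e f b m j"
    have "form (root_at e f b m j) (arc e f (b + real i * (pi / real m) + pi / 2))
        = form (root_at e f b m i) (arc e f (b + real i * (pi / real m) + pi / 2))"
      by (simp only: eq)
    then have "sin (b + real j * (pi / real m) - (b + real i * (pi / real m))) = 0"
      unfolding root_at_def form_arc_quarter[OF on] by simp
    moreover have "b + real j * (pi / real m) - (b + real i * (pi / real m)) = real (j - i) * (pi / real m)"
      using ij by (simp add: of_nat_diff left_diff_distrib diff_divide_distrib)
    moreover have "0 < sin (real (j - i) * (pi / real m))"
    proof (rule sin_gt_zero)
      show "0 < real (j - i) * (pi / real m)" using ij by simp
      have "real (j - i) * (pi / real m) < real m * (pi / real m)"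
        using ij by (intro mult_strict_right_mono) auto
      then show "real (j - i) * (pi / real m) < pi" using ij by simp
    qed
    ultimately show False by simp
  qed
qed (rule linear)

text \<open>In the commutator, the pairs of positive roots are grouped by the plane they span; there
  the coefficient is a constant multiple of the sine of the angle.\<close>

lemma dunkl_sum_commute:
  assumes L: "linear_functional L" and M: "linear_functional M"
  shows "dunkl_sum L * dunkl_sum M - dunkl_sum M * dunkl_sum L \<in> I"
proof -
  define B where "B = (\<lambda>(\<gamma>, \<delta>). quad_term (L \<gamma> * M \<delta> - M \<gamma> * L \<delta>) \<gamma> \<delta>)"
  define P where "P = {(\<gamma>, \<delta>). \<gamma> \<in> \<Delta>\<^sub>+ \<and> \<delta> \<in> \<Delta>\<^sub>+ \<and> \<gamma> \<noteq> \<delta>}"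
  \<comment> \<open>A plane is represented by its finite set of positive roots, which then serves as
    index set of the double sum for that plane.\<close>
  define Q where "Q = (\<lambda>(\<gamma>, \<delta>). plane \<gamma> \<delta> \<inter> \<Delta>\<^sub>+)"
  have B_diag: "B (\<gamma>, \<gamma>) = 0" for \<gamma> by (simp add: B_def mult.commute)
  have "P \<subseteq> \<Delta>\<^sub>+ \<times> \<Delta>\<^sub>+" by (auto simp: P_def)
  then have finP: "finite P" by (rule finite_subset) simp
  have "dunkl_sum L * dunkl_sum M - dunkl_sum M * dunkl_sum L = (\<Sum>\<gamma>\<in>\<Delta>\<^sub>+. \<Sum>\<delta>\<in>\<Delta>\<^sub>+. B (\<gamma>, \<delta>))"
    by (simp add: dunkl_sum_mult B_def quad_term_diff sum_subtractf)
  also have "\<dots> = sum B (\<Delta>\<^sub>+ \<times> \<Delta>\<^sub>+)"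
    by (simp add: sum.cartesian_product)
  also have "\<dots> = sum B P"
    using B_diag by (intro sum.mono_neutral_right) (auto simp: P_def)
  also have "\<dots> = (\<Sum>R\<in>Q ` P. sum B {p \<in> P. Q p = R})"
    using finP by (intro sum.group[symmetric]) auto
  also have "\<dots> \<in> I"
  proof (rule I_sum)
    fix R assume "R \<in> Q ` P"
    then obtain \<gamma> \<delta> where R: "R = plane \<gamma> \<delta> \<inter> \<Delta>\<^sub>+" and
      \<gamma>\<delta>: "\<gamma> \<in> \<Delta>\<^sub>+" "\<delta> \<in> \<Delta>\<^sub>+" "\<gamma> \<noteq> \<delta>"
      by (auto simp: P_def Q_def)
    obtain e f where ef: "adapted e f" "\<gamma> \<in> plane e f" "\<delta> \<in> plane e f"
      using adapted_basis[OF \<gamma>\<delta>] .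
    obtain x where x: "0 < x" "x < pi" "\<gamma> = arc e f x"
      using pos_root_in_plane_arc[OF ef(1,2) \<gamma>\<delta>(1)] .
    obtain y where y: "0 < y" "y < pi" "\<delta> = arc e f y"
      using pos_root_in_plane_arc[OF ef(1,3) \<gamma>\<delta>(2)] .
    have "arc e f x \<in> \<Delta>" "arc e f y \<in> \<Delta>" "x \<noteq> y"
      using \<gamma>\<delta> x y by (auto simp: pos_root_iff)
    then obtain b m where ra: "root_angles e f b m"
      using root_angles_exist[OF ef(1), of x y] x y by blast
    let ?g = "root_at e f b m"
    have "R = plane e f \<inter> \<Delta>\<^sub>+"
      unfolding R using plane_pos_roots[OF ef \<gamma>\<delta>] by simp
    then have Rg: "R = ?g ` {..<m}" and R': "R = plane e f \<inter> \<Delta>\<^sub>+"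
      using pos_roots_in_plane[OF ra] by simp_all
    have "p \<in> P \<and> Q p = R \<longleftrightarrow> p \<in> R \<times> R \<and> fst p \<noteq> snd p" for p
    proof
      assume p: "p \<in> P \<and> Q p = R"
      obtain u v where uv: "p = (u, v)" by (cases p)
      have "u \<in> plane u v" "v \<in> plane u v"
        using planeI[of 1 u 0 v] planeI[of 0 u 1 v] by simp_all
      then show "p \<in> R \<times> R \<and> fst p \<noteq> snd p"
        using p by (auto simp: uv P_def Q_def)
    next
      assume p: "p \<in> R \<times> R \<and> fst p \<noteq> snd p"
      obtain u v where uv: "p = (u, v)" by (cases p)
      have u: "u \<in> plane e f" "v \<in> plane e f" "u \<in> \<Delta>\<^sub>+" "v \<in> \<Delta>\<^sub>+" "u \<noteq> v"
        using p by (auto simp: uv R')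
      show "p \<in> P \<and> Q p = R"
        using u plane_pos_roots[OF ef(1) u] by (simp add: uv P_def Q_def R')
    qed
    then have "{p \<in> P. Q p = R} = {p \<in> R \<times> R. fst p \<noteq> snd p}" by blast
    then have "sum B {p \<in> P. Q p = R} = sum B {p \<in> R \<times> R. fst p \<noteq> snd p}" by (rule arg_cong)
    \<comment> \<open>The diagonal contributes zero and is put back to reach the full square of
      \<open>plane_sum\<close>.\<close>
    also have "\<dots> = sum B (R \<times> R)"
      using B_diag by (intro sum.mono_neutral_left) (auto simp: Rg)
    also have "\<dots> = (\<Sum>u\<in>R. \<Sum>v\<in>R. B (u, v))"
      by (simp add: sum.cartesian_product)
    also have "\<dots> = (\<Sum>i<m. \<Sum>j<m. B (?g i, ?g j))"
      unfolding Rg by (simp add: sum.reindex[OF root_at_inj[OF ra]])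
    also have "\<dots> = (\<Sum>i<m. \<Sum>j<m. quad_term ((L e * M f - M e * L f) * sin ((real j - real i) * (pi / real m))) (?g i) (?g j))"
    proof (intro sum.cong HOL.refl)
      fix i j
      have "b + real j * (pi / real m) - (b + real i * (pi / real m)) = (real j - real i) * (pi / real m)"
        by (simp add: left_diff_distrib diff_divide_distrib)
      then show "B (?g i, ?g j) = quad_term ((L e * M f - M e * L f) * sin ((real j - real i) * (pi / real m))) (?g i) (?g j)"
        using linear_functional_wedge_arc[OF L M, of e f "b + real i * (pi / real m)" "b + real j * (pi / real m)"]
        by (simp only: B_def prod.case root_at_def)
    qed
    also have "\<dots> \<in> I" by (rule plane_sum[OF ra])
    finally show "sum B {p \<in> P. Q p = R} \<in> I" .
  qed
  finally show ?thesis .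
qed

section \<open>Passing to the quotient\<close>

lemma ring_hom_qBE_class: "ring_hom_ring free_bracket qBE qBE_class"
proof -
  have "qBE_class = (+>\<^bsub>free_bracket\<^esub>) qBE_ideal"
    by (rule ext) (simp add: qBE_class_def)
  then show ?thesis
    unfolding qBE_def using ideal.rcos_ring_hom_ring[OF ideal_qBE] by simp
qed

lemma qBE_class_closed: "x \<in> A \<Longrightarrow> qBE_class x \<in> carrier qBE"
  using ring_hom_closed[OF ring_hom_ring.homh[OF ring_hom_qBE_class]] .

lemma qBE_class_mult: "x \<in> A \<Longrightarrow> y \<in> A \<Longrightarrow> qBE_class (x * y) = qBE_class x \<otimes>\<^bsub>qBE\<^esub> qBE_class y"
  using ring_hom_mult[OF ring_hom_ring.homh[OF ring_hom_qBE_class]] by simp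

lemma qBE_class_add: "x \<in> A \<Longrightarrow> y \<in> A \<Longrightarrow> qBE_class (x + y) = qBE_class x \<oplus>\<^bsub>qBE\<^esub> qBE_class y"
  using ring_hom_add[OF ring_hom_ring.homh[OF ring_hom_qBE_class]] by simp

lemma ring_qBE: "ring qBE"
  unfolding qBE_def by (rule ideal.quotient_is_ring[OF ideal_qBE])

lemma qBE_class_0: "qBE_class 0 = \<zero>\<^bsub>qBE\<^esub>"
  using ring_hom_zero[OF ring_hom_ring.homh[OF ring_hom_qBE_class] ring_free_algebra ring_qBE] by simp

lemma qBE_class_eq:
  assumes "x \<in> A" "y \<in> A" "x - y \<in> I"
  shows "qBE_class x = qBE_class y"
proof -
  interpret Q: ring qBE by (rule ring_qBE)
  have "qBE_class (x - y) = \<zero>\<^bsub>qBE\<^esub>"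
    using assms(3) unfolding qBE_class_def qBE_def FactRing_def
    by (simp add: abelian_subgroup.a_rcos_const[OF abelian_subgroupI3[OF ideal.axioms(1)[OF ideal_qBE] ring.is_abelian_group[OF ring_free_algebra]]])
  then have "qBE_class ((x - y) + y) = \<zero>\<^bsub>qBE\<^esub> \<oplus>\<^bsub>qBE\<^esub> qBE_class y"
    using qBE_class_add[OF A_diff[OF assms(1,2)] assms(2)] by simp
  then show ?thesis using qBE_class_closed[OF assms(2)] by simp
qed

lemma qBE_class_sum:
  assumes "finite J" "\<And>i. i \<in> J \<Longrightarrow> h i \<in> A"
  shows "qBE_class (sum h J) = (\<Oplus>\<^bsub>qBE\<^esub>i\<in>J. qBE_class (h i))"
  using assms
proof (induction J)
  case empty
  interpret Q: ring qBE by (rule ring_qBE)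
  show ?case by (simp add: qBE_class_0)
next
  case (insert i J)
  interpret Q: ring qBE by (rule ring_qBE)
  have "qBE_class (sum h (insert i J)) = qBE_class (h i) \<oplus>\<^bsub>qBE\<^esub> qBE_class (sum h J)"
    using insert by (simp add: qBE_class_add A_sum)
  also have "\<dots> = (\<Oplus>\<^bsub>qBE\<^esub>i\<in>insert i J. qBE_class (h i))"
    using insert by (subst Q.finsum_insert) (auto simp: qBE_class_closed)
  finally show ?case .
qed

lemma qBE_smult_class:
  "x \<in> A \<Longrightarrow> qBE_smult (poly_const r) (qBE_class x) = qBE_class (fscalar (poly_const r) * x)"
  by (simp add: qBE_smult_def qBE_class_mult A_fscalar)

lemma fscalar_mult_single:
  "fscalar (poly_const r) * Poly_Mapping.single w (poly_const t) = Poly_Mapping.single w (poly_const (r * t))"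
  by (simp add: fscalar_def mult_single poly_const_mult plus_list_def)

text \<open>Roots have length 1, so the coroot of \<gamma> is 2 \<gamma> and the coefficient is
  linear in \<gamma>, as \<open>dunkl_sum_commute\<close> demands.\<close>

lemma quantum_chevalley_eq:
  "quantum_chevalley t = qBE_class (dunkl_sum (\<lambda>\<gamma>. 2 * form (\<omega> t) \<gamma>))"
proof -
  interpret Q: ring qBE by (rule ring_qBE)
  have root: "\<gamma> \<in> \<Delta>" if "\<gamma> \<in> \<Delta>\<^sub>+" for \<gamma> using that by (simp add: pos_roots_def)
  have "qBE_smult (poly_const (form (\<omega> t) (coroot \<gamma>))) (bracket \<gamma>)
      = qBE_class (Poly_Mapping.single [\<gamma>] (poly_const (2 * form (\<omega> t) \<gamma>)))" if "\<gamma> \<in> \<Delta>\<^sub>+" for \<gamma>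
  proof -
    have "fscalar (poly_const (2 * form (\<omega> t) \<gamma>)) * fgen \<gamma>
        = (Poly_Mapping.single [\<gamma>] (poly_const (2 * form (\<omega> t) \<gamma>)) :: ('a, 'a vec) free_alg)"
      using fscalar_mult_single[of "2 * form (\<omega> t) \<gamma>" "[\<gamma>]" 1] by (simp add: fgen_def)
    then show ?thesis
      using root[OF that] by (simp add: coroot_def bracket_def qBE_smult_class)
  qed
  moreover have "qBE_class (Poly_Mapping.single [\<gamma>] (poly_const (2 * form (\<omega> t) \<gamma>))) \<in> carrier qBE"
    if "\<gamma> \<in> \<Delta>\<^sub>+" for \<gamma>
    using root[OF that] by (intro qBE_class_closed single_in_free_algebra) auto
  ultimately have "quantum_chevalley t
      = (\<Oplus>\<^bsub>qBE\<^esub>\<gamma>\<in>\<Delta>\<^sub>+. qBE_class (Poly_Mapping.single [\<gamma>] (poly_const (2 * form (\<omega> t) \<gamma>))))"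
    unfolding quantum_chevalley_def by (intro Q.finsum_cong') auto
  also have "\<dots> = qBE_class (dunkl_sum (\<lambda>\<gamma>. 2 * form (\<omega> t) \<gamma>))"
    unfolding dunkl_sum_def using root
    by (intro qBE_class_sum[symmetric] finite_pos_roots single_in_free_algebra) auto
  finally show ?thesis .
qed

text \<open>Interchanging the sums over S and over the positive roots merges the Chevalley elements
  into one sum, whose coefficient is again linear in \<gamma>.\<close>

lemma quantum_dunkl_eq:
  "quantum_dunkl s = qBE_class (dunkl_sum (\<lambda>\<gamma>. \<Sum>t\<in>S. form (\<alpha> s) (\<alpha> t) * (2 * form (\<omega> t) \<gamma>)))"
proof -
  interpret Q: ring qBE by (rule ring_qBE)
  define r where "r = (\<lambda>t. form (\<alpha> s) (\<alpha> t))"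
  define L where "L = (\<lambda>t \<gamma>. 2 * form (\<omega> t) \<gamma>)"
  have mem: "fscalar (poly_const (r t)) * dunkl_sum (L t) \<in> A" for t
    by (intro A_mult A_fscalar A_dunkl_sum poly_const_polys)
  have "quantum_dunkl s = (\<Oplus>\<^bsub>qBE\<^esub>t\<in>S. qBE_class (fscalar (poly_const (r t)) * dunkl_sum (L t)))"
    unfolding quantum_dunkl_def
    by (intro Q.finsum_cong')
      (auto simp: quantum_chevalley_eq L_def r_def A_dunkl_sum qBE_smult_class
        intro!: qBE_class_closed A_mult A_fscalar)
  also have "\<dots> = qBE_class (\<Sum>t\<in>S. fscalar (poly_const (r t)) * dunkl_sum (L t))"
    using mem by (intro qBE_class_sum[symmetric]) auto
  also have "(\<Sum>t\<in>S. fscalar (poly_const (r t)) * dunkl_sum (L t)) = dunkl_sum (\<lambda>\<gamma>. \<Sum>t\<in>S. r t * L t \<gamma>)"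
  proof -
    have sum_single: "(\<Sum>t\<in>T. Poly_Mapping.single w (poly_const (h t))) = Poly_Mapping.single w (poly_const (sum h T))"
      if "finite T" for T w and h :: "'a \<Rightarrow> real"
      using that by (induction T) (simp_all add: poly_const_add single_add)
    show ?thesis
      unfolding dunkl_sum_def sum_distrib_left fscalar_mult_single
      by (subst sum.swap) (simp add: sum_single)
  qed
  finally show ?thesis by (simp add: r_def L_def)
qed

lemma quantum_dunkl_commute:
  "quantum_dunkl s \<otimes>\<^bsub>qBE\<^esub> quantum_dunkl t = quantum_dunkl t \<otimes>\<^bsub>qBE\<^esub> quantum_dunkl s"
proof -
  define L where "L = (\<lambda>s \<gamma>. \<Sum>t\<in>S. form (\<alpha> s) (\<alpha> t) * (2 * form (\<omega> t) \<gamma>))"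
  have L: "linear_functional (L s)" for s
    by (simp add: linear_functional_def L_def form_add_right sum.distrib[symmetric]
        sum_distrib_left algebra_simps)
  have eq: "quantum_dunkl s = qBE_class (dunkl_sum (L s))" for s
    by (simp add: quantum_dunkl_eq L_def)
  show ?thesis
    unfolding eq
    using qBE_class_eq[OF _ _ dunkl_sum_commute[OF L L]]
    by (simp add: qBE_class_mult[symmetric] A_dunkl_sum A_mult)
qed

end

theorem theorem6p1:
  fixes W :: "('a, 'b) monoid_scheme" and S :: "'a set" and c :: "'a \<Rightarrow> real"
  assumes "coxeter_system W S"
    and "finite (carrier W)"
    and "coxeter_data.root_normalization W S c"
  shows "\<forall>s\<in>S. \<forall>t\<in>S.
    coxeter_data.quantum_dunkl W S c s \<otimes>\<^bsub>coxeter_data.qBE W S c\<^esub> coxeter_data.quantum_dunkl W S c t =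
    coxeter_data.quantum_dunkl W S c t \<otimes>\<^bsub>coxeter_data.qBE W S c\<^esub> coxeter_data.quantum_dunkl W S c s"
proof -
  interpret finite_coxeter_system W S c
    by standard (use assms in auto)
  show ?thesis using quantum_dunkl_commute by blast
qed

end
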